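(* Let $M_1$ and $M_2$ be matroids on disjoint finite ground sets $E_1$ and $E_2$, respectively, and let $M=M_1\oplus M_2$. Then: (a) $I(M)=I(M_1)\cdot I(M_2)$ (where $I(M_1)$ and $I(M_2)$ are extended to $\mathbb{K}[x_e : e\in E_1\cup E_2]$). (b) $\widehat{\alpha}(I(M))=\widehat{\alpha}(I(M_1))+\widehat{\alpha}(I(M_2))$. (c) $\widehat{\rho}(I(M))=\max\{\widehat{\rho}(I(M_1)),\widehat{\rho}(I(M_2))\}$.
   Context: The direct sum $M_1\oplus M_2$ is the matroid on $E_1\cup E_2$ whose bases are the sets $B_1\cup B_2$ with $B_i$ a basis of $M_i$. Standing assumption: the given matroids satisfy $\mathrm{rk}(M)<|E|$. Let $\mathbb{K}$ be a field. For a matroid $M$ on a finite ground set $E$, let $S=\mathbb{K}[x_e : e\in E]$ and define the facet ideal $I(M)=\langle \prod_{e\in B}x_e : B \text{ a basis of } M\rangle\subset S$. For a squarefree monomial ideal $I\subset S$, the $s$-th symbolic power is $I^{(s)}=\bigcap_{P\in \mathrm{Min}(I)}P^s$, where $\mathrm{Min}(I)$ is the set of minimal primes of $I$ (for $I=S$, $I^{(s)}=S$). Let $\alpha(I)$ be the least degree of a nonzero homogeneous element of $I$. The Waldschmidt constant is $\widehat{\alpha}(I)=\lim_{s\to\infty}\alpha(I^{(s)})/s$. The asymptotic resurgence is $\widehat{\rho}(I)=\sup\{s/r : s,r \text{ positive integers},\ I^{(st)}\not\subset I^{rt}\text{ for all } t\gg 0\}$ (the supremum of the empty set, occurring only for the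 unit ideal, is read as $0$). *)

theory Defs
  imports
    "HOL-Algebra.Ideal_Product"
    "HOL-Library.Poly_Mapping"
    "HOL-Analysis.Extended_Real_Limits"
begin

section \<open>Matroids, given by their bases\<close>

record 'a matroid_data =
  ground :: "'a set"
  bases :: "'a set set"

definition matroid :: "'a matroid_data \<Rightarrow> bool" where
  "matroid M \<longleftrightarrow>
     finite (ground M) \<and> bases M \<noteq> {} \<and> (\<forall>B\<in>bases M. B \<subseteq> ground M) \<and>
     (\<forall>A\<in>bases M. \<forall>B\<in>bases M. \<forall>a\<in>A - B. \<exists>b\<in>B - A. insert b (A - {a}) \<in> bases M)"

text \<open>The maximum is only a way to pick the common cardinality of the bases.\<close>

definition matroid_rank :: "'a matroid_data \<Rightarrow> nat" where
  "matroid_rank M = Max (card ` bases M)"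

definition direct_sum :: "'a matroid_data \<Rightarrow> 'a matroid_data \<Rightarrow> 'a matroid_data" where
  "direct_sum M N =
     \<lparr> ground = ground M \<union> ground N,
       bases = {B \<union> C | B C. B \<in> bases M \<and> C \<in> bases N} \<rparr>"

lemma matroid_direct_sum:
  assumes M: "matroid M" and N: "matroid N" and disj: "ground M \<inter> ground N = {}"
  shows "matroid (direct_sum M N)"
proof -
  have sub: "B \<subseteq> ground M" if "B \<in> bases M" for B using M that by (auto simp: matroid_def)
  have sub': "B \<subseteq> ground N" if "B \<in> bases N" for B using N that by (auto simp: matroid_def)
  have exM: "\<exists>b\<in>B - A. insert b (A - {a}) \<in> bases M"
    if "A \<in> bases M" "B \<in> bases M" "a \<in> A - B" for A B a
    using M that unfolding matroid_def by blast
  have exN: "\<exists>b\<in>B - A. insert b (A - {a}) \<in> bases N"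
    if "A \<in> bases N" "B \<in> bases N" "a \<in> A - B" for A B a
    using N that unfolding matroid_def by blast
  have exchange: "\<exists>x\<in>(B \<union> B') - (A \<union> A'). \<exists>C C'. insert x ((A \<union> A') - {a}) = C \<union> C'
      \<and> C \<in> bases M \<and> C' \<in> bases N"
    if AB: "A \<in> bases M" "B \<in> bases M" "A' \<in> bases N" "B' \<in> bases N"
      and a: "a \<in> (A \<union> A') - (B \<union> B')" for A A' B B' a
  proof (cases "a \<in> A")
    case True
    then obtain x where x: "x \<in> B - A" "insert x (A - {a}) \<in> bases M"
      using exM[OF AB(1,2), of a] a by blast
    have "a \<notin> A'" "x \<notin> A'" using True x AB sub sub' disj by blast+
    then have "insert x ((A \<union> A') - {a}) = insert x (A - {a}) \<union> A'" by blast
    then show ?thesis using x AB(3) \<open>x \<notin> A'\<close> by blast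
  next
    case False
    then obtain x where x: "x \<in> B' - A'" "insert x (A' - {a}) \<in> bases N"
      using exN[OF AB(3,4), of a] a by blast
    have "x \<notin> A" using x AB sub sub' disj by blast
    moreover have "insert x ((A \<union> A') - {a}) = A \<union> insert x (A' - {a})" using False by blast
    ultimately show ?thesis using x AB(1) by blast
  qed
  have fin: "finite (ground M \<union> ground N)" using M N by (simp add: matroid_def)
  have ne: "{B \<union> C | B C. B \<in> bases M \<and> C \<in> bases N} \<noteq> {}"
    using M N by (auto simp: matroid_def)
  show ?thesis
    unfolding matroid_def direct_sum_def matroid_data.simps
  proof (intro conjI ballI)
    fix X Y a assume "X \<in> {B \<union> C | B C. B \<in> bases M \<and> C \<in> bases N}"
      "Y \<in> {B \<union> C | B C. B \<in> bases M \<and> C \<in> bases N}" and a: "a \<in> X - Y"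
    then obtain A A' B B' where *: "X = A \<union> A'" "Y = B \<union> B'"
      "A \<in> bases M" "B \<in> bases M" "A' \<in> bases N" "B' \<in> bases N" by blast
    show "\<exists>b\<in>Y - X. insert b (X - {a}) \<in> {B \<union> C | B C. B \<in> bases M \<and> C \<in> bases N}"
      using exchange[OF *(3-6), of a] a *(1,2) by blast
  qed (use fin ne sub sub' in blast)+
qed

section \<open>The polynomial rings K[x_e : e in E]\<close>

text \<open>
  Exponent vectors are finitely supported functions from variables to \<open>nat\<close>, and a polynomial
  is a finitely supported function from exponent vectors to the field \<open>'k\<close>. All of \<open>'a\<close> is
  available as variable names; the ring \<open>poly_ring E\<close> consists of the polynomials in which only
  the variables indexed by \<open>E\<close> occur.
\<close>

type_synonym ('a, 'k) mpoly = "('a \<Rightarrow>\<^sub>0 nat) \<Rightarrow>\<^sub>0 'k"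

definition poly_ring :: "'a set \<Rightarrow> ('a, 'k::field) mpoly ring" where
  "poly_ring E =
     \<lparr> carrier = {p. \<forall>m\<in>Poly_Mapping.keys p. Poly_Mapping.keys m \<subseteq> E},
       mult = (*), one = 1, zero = 0, add = (+) \<rparr>"

definition pvar :: "'a \<Rightarrow> ('a, 'k::field) mpoly" where
  "pvar e = Poly_Mapping.single (Poly_Mapping.single e 1) 1"

definition homogeneous :: "nat \<Rightarrow> ('a, 'k::field) mpoly \<Rightarrow> bool" where
  "homogeneous d p \<longleftrightarrow>
     (\<forall>m\<in>Poly_Mapping.keys p. (\<Sum>e\<in>Poly_Mapping.keys m. Poly_Mapping.lookup m e) = d)"

lemma poly_ring_cring: "cring (poly_ring E :: ('a, 'k::field) mpoly ring)"
proof (rule cringI)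
  let ?R = "poly_ring E :: ('a, 'k) mpoly ring"
  have add: "p + q \<in> carrier ?R" if "p \<in> carrier ?R" "q \<in> carrier ?R" for p q
    using that Poly_Mapping.keys_add[of p q] unfolding poly_ring_def by auto
  have mult: "p * q \<in> carrier ?R" if "p \<in> carrier ?R" "q \<in> carrier ?R" for p q
  proof -
    have "Poly_Mapping.keys m \<subseteq> E" if m: "m \<in> Poly_Mapping.keys (p * q)" for m
    proof -
      obtain a b where ab: "m = a + b" "a \<in> Poly_Mapping.keys p" "b \<in> Poly_Mapping.keys q"
        using m Poly_Mapping.keys_mult[of p q] by blast
      have "Poly_Mapping.keys a \<subseteq> E" "Poly_Mapping.keys b \<subseteq> E"
        using ab \<open>p \<in> carrier ?R\<close> \<open>q \<in> carrier ?R\<close> by (simp_all add: poly_ring_def)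
      then show ?thesis
        using Poly_Mapping.keys_add[of a b] unfolding ab(1) by (meson Un_least order_trans)
    qed
    then show ?thesis by (simp add: poly_ring_def)
  qed
  have minus: "- p \<in> carrier ?R" if "p \<in> carrier ?R" for p
    using that unfolding poly_ring_def by simp
  have zero: "0 \<in> carrier ?R" and one: "1 \<in> carrier ?R"
    unfolding poly_ring_def by simp_all
  have sel: "mult ?R = (*)" "one ?R = 1" "ring.zero ?R = 0" "add ?R = (+)"
    by (simp_all add: poly_ring_def)
  show "abelian_group ?R"
  proof (rule abelian_groupI, unfold sel)
    fix p assume "p \<in> carrier ?R"
    then show "\<exists>q\<in>carrier ?R. q + p = 0"
      using minus[of p] by (intro bexI[of _ "- p"]) simp_all
  qed (rule add zero add.assoc add.commute add_0_left; assumption?)+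
  show "comm_monoid ?R"
  proof (rule comm_monoidI, unfold sel)
  qed (rule mult one mult.assoc mult.commute mult_1_left; assumption?)+
  fix p q r :: "('a, 'k) mpoly"
  show "(p \<oplus>\<^bsub>?R\<^esub> q) \<otimes>\<^bsub>?R\<^esub> r = p \<otimes>\<^bsub>?R\<^esub> r \<oplus>\<^bsub>?R\<^esub> q \<otimes>\<^bsub>?R\<^esub> r"
    unfolding sel by (rule distrib_right)
qed

section \<open>Facet ideals and asymptotic invariants\<close>

definition facet_ideal :: "'k itself \<Rightarrow> 'a matroid_data \<Rightarrow> ('a, 'k::field) mpoly set" where
  "facet_ideal _ M = genideal (poly_ring (ground M)) {\<Prod>e\<in>B. pvar e | B. B \<in> bases M}"

definition minimal_primes :: "('c, 'b) ring_scheme \<Rightarrow> 'c set \<Rightarrow> 'c set set" where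
  "minimal_primes R I =
     {P. primeideal P R \<and> I \<subseteq> P \<and> (\<forall>Q. primeideal Q R \<and> I \<subseteq> Q \<and> Q \<subseteq> P \<longrightarrow> Q = P)}"

text \<open>The unit ideal has no minimal primes, and its symbolic powers are then \<open>carrier R\<close>.\<close>

definition symbolic_power :: "('c, 'b) ring_scheme \<Rightarrow> 'c set \<Rightarrow> nat \<Rightarrow> 'c set" where
  "symbolic_power R I s =
     {p \<in> carrier R. \<forall>P\<in>minimal_primes R I. p \<in> P [^]\<^bsub>ideals_set R\<^esub> s}"

definition initial_degree :: "('a, 'k::field) mpoly set \<Rightarrow> nat" where
  "initial_degree I = (LEAST d. \<exists>p\<in>I. p \<noteq> 0 \<and> homogeneous d p)"

definition waldschmidt_constant ::
    "('a, 'k::field) mpoly ring \<Rightarrow> ('a, 'k) mpoly set \<Rightarrow> real" where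
  "waldschmidt_constant R I = lim (\<lambda>s. real (initial_degree (symbolic_power R I s)) / real s)"

text \<open>The supremum is taken in \<^typ>\<open>ennreal\<close>, where the supremum of the empty set is 0.\<close>

definition asymptotic_resurgence :: "('c, 'b) ring_scheme \<Rightarrow> 'c set \<Rightarrow> ennreal" where
  "asymptotic_resurgence R I =
     Sup {ennreal (real s / real r) | s r. 0 < s \<and> 0 < r \<and>
       (\<forall>\<^sub>F t in sequentially.
          \<not> symbolic_power R I (s * t) \<subseteq> I [^]\<^bsub>ideals_set R\<^esub> (r * t))}"

end

theory Submission
  imports Defs
begin

text \<open>
  All ideals in sight are spanned by monomials, so everything is decided by exponent vectors
  \<open>f\<close>. A monomial lies in the power \<open>I(M)^n\<close> iff \<open>f\<close> dominates a sum of \<open>n\<close> indicator vectors of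
  bases (\<open>packs\<close>). The minimal primes of \<open>I(M)\<close> are generated by the variables in a minimal
  transversal of the bases, so a monomial lies in the symbolic power \<open>I(M)^(s)\<close> iff \<open>f\<close> has weight
  at least \<open>s\<close> on every transversal (\<open>covers\<close>); see \<open>facet_power\<close> and
  \<open>symbolic_power_monomial\<close>.

  For a direct sum both conditions split into the conditions for the two summands
  (\<open>packs_joins\<close>, \<open>covers_joins\<close>): a set meets all unions \<open>A \<union> B\<close> iff it meets all \<open>A\<close> or
  meets all \<open>B\<close>. Splitting of \<open>packs\<close> is the product formula for the ideals.
  Splitting of \<open>covers\<close> makes the initial degree of the symbolic power additive for each \<open>s\<close>; since
  these degrees are subadditive in \<open>s\<close>, Fekete's lemma gives the limits, and the Waldschmidt
  constants add up.

  For the resurgence, \<open>I(M)^(s) \<subseteq> I(M)^n\<close> holds iff it holds for both summands. Hence a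
  ratio \<open>s/r\<close> at which containment eventually fails for \<open>M\<close> is one at which, for every large \<open>t\<close>, it
  fails for one summand or the other, but which one may depend on \<open>t\<close>. To rule out that they
  alternate, \<open>contained_eventually\<close> shows that frequent containment at a ratio implies
  eventual containment at every larger ratio. This rests on \<open>contained_scale\<close>: from
  \<open>I^(a) \<subseteq> I^b\<close> it follows that \<open>I^(q a) \<subseteq> I^(q (b - |E|))\<close> for all \<open>q\<close>. Indeed, if
  \<open>f\<close> covers \<open>q a\<close>, then rounding \<open>f/q\<close> up gives a vector that packs \<open>b\<close> bases, so \<open>f + (q, ..., q)\<close>
  packs \<open>q b\<close> bases, and discarding at most \<open>q\<close> bases through each point of \<open>E\<close> repairs the excess.
  When \<open>a\<close> and \<open>b\<close> are large, the loss of \<open>|E|\<close> is negligible compared with \<open>b\<close>.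
\<close>

section \<open>Packings and covers of a set family\<close>

text \<open>
  The exponent vector \<open>f\<close> is divisible by a product of \<open>n\<close> of the squarefree monomials with
  supports in \<open>\<B>\<close>, repetitions allowed.
\<close>
definition packs :: "'a set set \<Rightarrow> nat \<Rightarrow> ('a \<Rightarrow> nat) \<Rightarrow> bool" where
  "packs \<B> n f \<longleftrightarrow> (\<exists>F. (\<forall>i<n. F i \<in> \<B>) \<and> (\<forall>e. card {i. i < n \<and> e \<in> F i} \<le> f e))"

definition transversals :: "'a set \<Rightarrow> 'a set set \<Rightarrow> 'a set set" where
  "transversals E \<B> = {T. T \<subseteq> E \<and> (\<forall>B\<in>\<B>. B \<inter> T \<noteq> {})}"

definition covers :: "'a set \<Rightarrow> 'a set set \<Rightarrow> nat \<Rightarrow> ('a \<Rightarrow> nat) \<Rightarrow> bool" where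
  "covers E \<B> s f \<longleftrightarrow> (\<forall>T\<in>transversals E \<B>. s \<le> sum f T)"

text \<open>
  The combinatorial form of the containment of the \<open>s\<close>-th symbolic power in the \<open>n\<close>-th power.
\<close>
definition contained :: "'a set \<Rightarrow> 'a set set \<Rightarrow> nat \<Rightarrow> nat \<Rightarrow> bool" where
  "contained E \<B> s n \<longleftrightarrow> (\<forall>f. covers E \<B> s f \<longrightarrow> packs \<B> n f)"

definition least_weight :: "'a set \<Rightarrow> 'a set set \<Rightarrow> nat \<Rightarrow> nat" where
  "least_weight E \<B> s = (LEAST d. \<exists>f. covers E \<B> s f \<and> sum f E = d)"

definition joins :: "'a set set \<Rightarrow> 'a set set \<Rightarrow> 'a set set" where
  "joins \<A> \<B> = {A \<union> B | A B. A \<in> \<A> \<and> B \<in> \<B>}"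

lemma packs_mono: "packs \<B> n f \<Longrightarrow> (\<And>e. f e \<le> g e) \<Longrightarrow> packs \<B> n g"
  unfolding packs_def by (meson order_trans)

lemma packs_fewer:
  assumes "packs \<B> n f" "k \<le> n"
  shows "packs \<B> k f"
proof -
  obtain F where F: "\<forall>i<n. F i \<in> \<B>" "\<And>e. card {i. i < n \<and> e \<in> F i} \<le> f e"
    using assms(1) unfolding packs_def by blast
  have "card {i. i < k \<and> e \<in> F i} \<le> f e" for e
    using assms(2) by (intro order_trans[OF card_mono F(2)]) auto
  then show ?thesis using F(1) assms(2) unfolding packs_def by (intro exI[of _ F]) auto
qed

text \<open>
  Packings indexed by an arbitrary finite set are the natural outcome of discarding members;
  an enumeration of the index set brings them back to the index set \<open>{..<n}\<close>.
\<close>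
lemma packs_family:
  assumes "finite J" "\<And>j. j \<in> J \<Longrightarrow> F j \<in> \<B>" "\<And>e. card {j \<in> J. e \<in> F j} \<le> f e"
  shows "packs \<B> (card J) f"
proof -
  obtain h where h: "bij_betw h {0..<card J} J"
    using ex_bij_betw_nat_finite[OF assms(1)] by blast
  have "card {i. i < card J \<and> e \<in> F (h i)} = card {j \<in> J. e \<in> F j}" for e
  proof (rule bij_betw_same_card)
    have "h ` {i. i < card J \<and> e \<in> F (h i)} = {j \<in> J. e \<in> F j}"
    proof (intro equalityI subsetI)
      fix j assume j: "j \<in> {j \<in> J. e \<in> F j}"
      then obtain i where "i < card J" "j = h i"
        using bij_betw_imp_surj_on[OF h] by (metis (no_types, lifting) atLeastLessThan_iff imageE mem_Collect_eq)
      with j show "j \<in> h ` {i. i < card J \<and> e \<in> F (h i)}" by auto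
    qed (use bij_betwE[OF h] in auto)
    then show "bij_betw h {i. i < card J \<and> e \<in> F (h i)} {j \<in> J. e \<in> F j}"
      by (intro bij_betw_subset[OF h]) auto
  qed
  moreover have "F (h i) \<in> \<B>" if "i < card J" for i
    using assms(2) bij_betwE[OF h] that by auto
  ultimately show ?thesis
    unfolding packs_def by (intro exI[of _ "\<lambda>i. F (h i)"]) (simp add: assms(3))
qed

lemma packs_0: "packs \<B> 0 f"
  by (simp add: packs_def)

lemma packs_1: "packs \<B> 1 f \<longleftrightarrow> (\<exists>B\<in>\<B>. \<forall>e\<in>B. 1 \<le> f e)"
proof
  assume "packs \<B> 1 f"
  then obtain F :: "nat \<Rightarrow> _" where F: "\<forall>i<1. F i \<in> \<B>" "\<And>e. card {i. i < 1 \<and> e \<in> F i} \<le> f e"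
    unfolding packs_def by blast
  have "1 \<le> f e" if "e \<in> F 0" for e
  proof -
    have "{i. i < 1 \<and> e \<in> F i} = {0::nat}" using that by auto
    then show ?thesis using F(2)[of e] by simp
  qed
  moreover have "F 0 \<in> \<B>" using F(1) by simp
  ultimately show "\<exists>B\<in>\<B>. \<forall>e\<in>B. 1 \<le> f e" by blast
next
  assume "\<exists>B\<in>\<B>. \<forall>e\<in>B. 1 \<le> f e"
  then obtain B where B: "B \<in> \<B>" "\<And>e. e \<in> B \<Longrightarrow> 1 \<le> f e" by blast
  have "card {i. i < (1::nat) \<and> e \<in> B} \<le> f e" for e
    using B(2)[of e] by (cases "e \<in> B") auto
  then show "packs \<B> 1 f" unfolding packs_def using B(1) by (intro exI[of _ "\<lambda>_. B"]) auto
qed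

lemma packs_add:
  assumes "packs \<B> m f" "packs \<B> n g"
  shows "packs \<B> (m + n) (\<lambda>e. f e + g e)"
proof -
  obtain F where F: "\<forall>i<m. F i \<in> \<B>" "\<And>e. card {i. i < m \<and> e \<in> F i} \<le> f e"
    using assms(1) unfolding packs_def by blast
  obtain G where G: "\<forall>i<n. G i \<in> \<B>" "\<And>e. card {i. i < n \<and> e \<in> G i} \<le> g e"
    using assms(2) unfolding packs_def by blast
  define H where "H i = (if i < m then F i else G (i - m))" for i
  have "card {i. i < m + n \<and> e \<in> H i} \<le> f e + g e" for e
  proof -
    have "{i. i < m + n \<and> e \<in> H i} \<subseteq>
        {i. i < m \<and> e \<in> F i} \<union> (\<lambda>i. i + m) ` {i. i < n \<and> e \<in> G i}"
    proof
      fix i assume i: "i \<in> {i. i < m + n \<and> e \<in> H i}"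
      show "i \<in> {i. i < m \<and> e \<in> F i} \<union> (\<lambda>i. i + m) ` {i. i < n \<and> e \<in> G i}"
      proof (cases "i < m")
        case False
        with i have "i = (i - m) + m" "i - m \<in> {i. i < n \<and> e \<in> G i}"
          by (auto simp: H_def)
        then show ?thesis by blast
      qed (use i in \<open>auto simp: H_def\<close>)
    qed
    then have "card {i. i < m + n \<and> e \<in> H i} \<le>
        card ({i. i < m \<and> e \<in> F i} \<union> (\<lambda>i. i + m) ` {i. i < n \<and> e \<in> G i})"
      by (intro card_mono) auto
    also have "\<dots> \<le> card {i. i < m \<and> e \<in> F i} + card ((\<lambda>i. i + m) ` {i. i < n \<and> e \<in> G i})"
      by (rule card_Un_le)
    also have "\<dots> \<le> card {i. i < m \<and> e \<in> F i} + card {i. i < n \<and> e \<in> G i}"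
      by (simp add: card_image_le)
    also have "\<dots> \<le> f e + g e" using F(2)[of e] G(2)[of e] by linarith
    finally show ?thesis .
  qed
  then show ?thesis
    unfolding packs_def using F(1) G(1) by (intro exI[of _ H]) (auto simp: H_def)
qed

lemma packs_scale: "packs \<B> n f \<Longrightarrow> packs \<B> (q * n) (\<lambda>e. q * f e)"
proof (induction q)
  case (Suc q)
  then show ?case using packs_add[of \<B> n f "q * n"] by simp
qed (simp add: packs_0)

text \<open>
  The last member of the packing is split off as its indicator vector. With exact equality of
  \<open>h\<close> and the sum, this is the recursion that powers of monomial ideals obey.
\<close>
lemma packs_Suc:
  "packs \<B> (Suc n) h \<longleftrightarrow> (\<exists>f g. packs \<B> n f \<and> packs \<B> 1 g \<and> h = (\<lambda>e. f e + g e))"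
proof
  assume "packs \<B> (Suc n) h"
  then obtain F where F: "\<forall>i<Suc n. F i \<in> \<B>" "\<And>e. card {i. i < Suc n \<and> e \<in> F i} \<le> h e"
    unfolding packs_def by blast
  define g where "g e = (if e \<in> F n then 1 else 0 :: nat)" for e
  have *: "card {i. i < Suc n \<and> e \<in> F i} = card {i. i < n \<and> e \<in> F i} + g e" for e
  proof (cases "e \<in> F n")
    case True
    then have "{i. i < Suc n \<and> e \<in> F i} = insert n {i. i < n \<and> e \<in> F i}"
      by (auto simp: less_Suc_eq)
    then show ?thesis using True by (simp add: g_def)
  next
    case False
    then have "{i. i < Suc n \<and> e \<in> F i} = {i. i < n \<and> e \<in> F i}"
      by (auto simp: less_Suc_eq)
    then show ?thesis using False by (simp add: g_def)
  qed
  have le: "card {i. i < n \<and> e \<in> F i} + g e \<le> h e" for e using F(2)[of e] * by simp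
  have "card {i. i < n \<and> e \<in> F i} \<le> h e - g e" for e using le[of e] by simp
  then have "packs \<B> n (\<lambda>e. h e - g e)"
    unfolding packs_def using F(1) by (intro exI[of _ F]) auto
  moreover have "packs \<B> 1 g" unfolding packs_1 using F(1) by (intro bexI[of _ "F n"]) (auto simp: g_def)
  moreover have "h = (\<lambda>e. (h e - g e) + g e)"
  proof
    fix e show "h e = h e - g e + g e" using le[of e] by simp
  qed
  ultimately show "\<exists>f g. packs \<B> n f \<and> packs \<B> 1 g \<and> h = (\<lambda>e. f e + g e)" by blast
next
  assume "\<exists>f g. packs \<B> n f \<and> packs \<B> 1 g \<and> h = (\<lambda>e. f e + g e)"
  then show "packs \<B> (Suc n) h" using packs_add[of \<B> n _ 1] by auto
qed

text \<open>
  For each \<open>e\<close> it suffices to discard \<open>q\<close> members through \<open>e\<close>, or all of them if there are fewer: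
  then either the multiplicity of \<open>e\<close> has dropped by \<open>q\<close>, or it is zero.
\<close>
lemma packs_prune:
  assumes E: "finite E" "\<B> \<subseteq> Pow E"
    and p: "packs \<B> n (\<lambda>e. f e + q)"
  shows "packs \<B> (n - q * card E) f"
proof -
  obtain F where F: "\<forall>i<n. F i \<in> \<B>" "\<And>e. card {i. i < n \<and> e \<in> F i} \<le> f e + q"
    using p unfolding packs_def by blast
  define D where "D e = {i. i < n \<and> e \<in> F i}" for e
  have "\<exists>R. R \<subseteq> D e \<and> card R = min q (card (D e))" for e
    using obtain_subset_with_card_n[of "min q (card (D e))" "D e"] by auto
  then obtain R where R: "\<And>e. R e \<subseteq> D e" "\<And>e. card (R e) = min q (card (D e))" by metis
  define J where "J = {..<n} - (\<Union>e\<in>E. R e)"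
  have finD: "finite (D e)" for e unfolding D_def by simp
  have finR: "finite (R e)" for e using R(1) finD by (rule finite_subset)
  have "card {j \<in> J. e \<in> F j} \<le> f e" for e
  proof (cases "e \<in> E")
    case True
    have "{j \<in> J. e \<in> F j} \<subseteq> D e - R e" using True by (auto simp: J_def D_def)
    then have "card {j \<in> J. e \<in> F j} \<le> card (D e - R e)" using finD by (intro card_mono) auto
    also have "\<dots> = card (D e) - min q (card (D e))" using R finR by (simp add: card_Diff_subset)
    also have "\<dots> \<le> f e" using F(2)[of e] unfolding D_def by linarith
    finally show ?thesis .
  next
    case False
    then have "{j \<in> J. e \<in> F j} = {}" unfolding J_def using E(2) F(1) by blast
    then show ?thesis by (metis card.empty le0)
  qed
  moreover have "F j \<in> \<B>" if "j \<in> J" for j using F(1) that by (auto simp: J_def)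
  ultimately have packJ: "packs \<B> (card J) f" by (intro packs_family) (auto simp: J_def)
  have "card (\<Union>e\<in>E. R e) \<le> (\<Sum>e\<in>E. card (R e))" using E(1) by (rule card_UN_le)
  also have "\<dots> \<le> (\<Sum>e\<in>E. q)" by (intro sum_mono) (simp add: R)
  finally have "card (\<Union>e\<in>E. R e) \<le> q * card E" by (simp add: mult.commute)
  moreover have "card {..<n} - card (\<Union>e\<in>E. R e) \<le> card J"
    unfolding J_def using E(1) finR by (intro diff_card_le_card_Diff) auto
  ultimately have "n - q * card E \<le> card J" by simp
  then show ?thesis using packJ packs_fewer by blast
qed

section \<open>Asymptotic containment\<close>

text \<open>
  Rounding \<open>f/q\<close> up keeps every transversal weight at least \<open>a\<close>, and multiplying back by \<open>q\<close>
  overshoots \<open>f\<close> by less than \<open>q\<close> in each coordinate, which pruning removes.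
\<close>

lemma contained_scale:
  assumes E: "finite E" "\<B> \<subseteq> Pow E"
    and c: "contained E \<B> a b"
  shows "contained E \<B> (q * a) (q * (b - card E))"
proof (cases "q = 0")
  case False
  show ?thesis
    unfolding contained_def
  proof (intro allI impI)
    fix f assume f: "covers E \<B> (q * a) f"
    \<comment> \<open>The ceiling of \<open>f e / q\<close>.\<close>
    define g where "g e = (f e + (q - 1)) div q" for e
    have g1: "f e \<le> q * g e" for e
    proof -
      have "f e + (q - 1) = q * g e + (f e + (q - 1)) mod q" unfolding g_def by simp
      moreover have "(f e + (q - 1)) mod q < q" using False by simp
      ultimately show ?thesis by linarith
    qed
    have g2: "q * g e \<le> f e + q" for e
    proof -
      have "q * g e \<le> f e + (q - 1)" unfolding g_def by simp
      then show ?thesis by linarith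
    qed
    have "covers E \<B> a g"
      unfolding covers_def
    proof
      fix T assume "T \<in> transversals E \<B>"
      then have "q * a \<le> sum f T" using f by (simp add: covers_def)
      also have "\<dots> \<le> (\<Sum>e\<in>T. q * g e)" by (intro sum_mono g1)
      also have "\<dots> = q * sum g T" by (simp add: sum_distrib_left)
      finally show "a \<le> sum g T" using False by simp
    qed
    then have "packs \<B> b g" using c by (simp add: contained_def)
    then have "packs \<B> (q * b) (\<lambda>e. f e + q)"
      by (intro packs_mono[OF packs_scale g2])
    then have "packs \<B> (q * b - q * card E) f" by (rule packs_prune[OF E, rotated])
    then show "packs \<B> (q * (b - card E)) f" by (simp add: diff_mult_distrib2)
  qed
qed (simp add: contained_def packs_0)

lemma contained_weaken:
  assumes "contained E \<B> s n" "s \<le> s'" "n' \<le> n"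
  shows "contained E \<B> s' n'"
  using assms packs_fewer unfolding contained_def covers_def by (meson order_trans)

text \<open>
  The strict inequality of ratios leaves room for the loss of \<open>card E\<close> in the previous scaling
  lemma as soon as it is applied at a large \<open>t0\<close>; a general \<open>t\<close> is then reduced to the largest
  multiple of \<open>s' * t0\<close> below \<open>s * t\<close>.
\<close>
lemma contained_eventually:
  assumes E: "finite E" "\<B> \<subseteq> Pow E"
    and freq: "\<exists>\<^sub>F t in sequentially. contained E \<B> (s' * t) (r' * t)"
    and pos: "0 < s'" and less: "r * s' < r' * s"
  shows "\<forall>\<^sub>F t in sequentially. contained E \<B> (s * t) (r * t)"
proof -
  \<comment> \<open>Passing from \<open>r' * t0\<close> to \<open>r' * t0 - card E\<close> costs \<open>s * card E\<close> after multiplication by \<open>s\<close>,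
    while \<open>r' * s - r * s' \<ge> 1\<close> gains at least \<open>t0\<close>.\<close>
  obtain t0 where t0: "s * card E < t0" "contained E \<B> (s' * t0) (r' * t0)"
    using freq unfolding frequently_sequentially by (meson Suc_le_lessD)
  define a c where "a = s' * t0" and "c = r' * t0 - card E"
  have a: "0 < a" using t0(1) pos by (simp add: a_def)
  have scale: "contained E \<B> (q * a) (q * c)" for q
    unfolding a_def c_def using contained_scale[OF E t0(2)] .
  have ac: "r * a + 1 \<le> s * c"
  proof -
    have "(r * s' + 1) * t0 \<le> (r' * s) * t0" using less by (intro mult_right_mono) auto
    then have "r * a + t0 \<le> s * (r' * t0)" by (simp add: a_def algebra_simps)
    then show ?thesis using t0(1) by (simp add: c_def diff_mult_distrib2)
  qed
  have "contained E \<B> (s * t) (r * t)" if t: "a * c \<le> t" for t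
  proof -
    define q where "q = (s * t) div a"
    have q1: "q * a \<le> s * t" unfolding q_def by simp
    have "s * t < a * (q + 1)" unfolding q_def using a by (simp add: dividend_less_times_div)
    then have "(s * t) * c \<le> (a * (q + 1)) * c" by (intro mult_right_mono) auto
    moreover have "(r * a + 1) * t \<le> (s * c) * t" using ac by (intro mult_right_mono) auto
    ultimately have "a * (r * t) + t \<le> a * (q * c) + a * c" by (simp add: algebra_simps)
    with t have "a * (r * t) \<le> a * (q * c)" by linarith
    then have "r * t \<le> q * c" using a by simp
    with scale q1 show ?thesis using contained_weaken by blast
  qed
  then show ?thesis unfolding eventually_sequentially by blast
qed

text \<open>
  If eventual failure of the conjunction held at a ratio \<open>s/r\<close> above both suprema, then at a
  rational \<open>s'/r'\<close> strictly between, neither condition fails eventually, so both hold frequently;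
  by \<open>step\<close> both hold eventually at \<open>s/r\<close>, hence simultaneously.
\<close>
lemma Sup_failing_ratios_conj:
  fixes C :: "'i \<Rightarrow> nat \<Rightarrow> nat \<Rightarrow> bool"
  defines "A \<equiv> \<lambda>P. {ennreal (real s / real r) | s r. 0 < s \<and> 0 < r \<and>
       (\<forall>\<^sub>F t in sequentially. \<not> P (s * t) (r * t))}"
  assumes step: "\<And>i s r s' r'. \<exists>\<^sub>F t in sequentially. C i (s' * t) (r' * t) \<Longrightarrow> 0 < s' \<Longrightarrow>
       r * s' < r' * s \<Longrightarrow> \<forall>\<^sub>F t in sequentially. C i (s * t) (r * t)"
  shows "Sup (A (\<lambda>s n. C i s n \<and> C j s n)) = max (Sup (A (C i))) (Sup (A (C j)))"
proof (rule antisym)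
  show "max (Sup (A (C i))) (Sup (A (C j))) \<le> Sup (A (\<lambda>s n. C i s n \<and> C j s n))"
    unfolding A_def by (intro max.boundedI Sup_subset_mono) (auto elim!: eventually_mono)
  show "Sup (A (\<lambda>s n. C i s n \<and> C j s n)) \<le> max (Sup (A (C i))) (Sup (A (C j)))"
  proof (rule Sup_least, rule ccontr)
    fix x assume "x \<in> A (\<lambda>s n. C i s n \<and> C j s n)"
    then obtain s r where x: "x = ennreal (real s / real r)" "0 < s" "0 < r"
      and ev: "\<forall>\<^sub>F t in sequentially. \<not> (C i (s * t) (r * t) \<and> C j (s * t) (r * t))"
      unfolding A_def by blast
    assume "\<not> x \<le> max (Sup (A (C i))) (Sup (A (C j)))"
    then have "max (Sup (A (C i))) (Sup (A (C j))) < ennreal (real s / real r)"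
      using x by (simp add: not_le)
    then obtain w where w: "max (Sup (A (C i))) (Sup (A (C j))) < w" "w < ennreal (real s / real r)"
      using dense by blast
    then obtain y where wy: "w = ennreal y" "0 \<le> y" by (cases w) auto
    with w have y: "max (Sup (A (C i))) (Sup (A (C j))) < ennreal y" "y < real s / real r" "0 \<le> y"
      by (simp_all add: ennreal_less_iff)
    then obtain z where z: "z \<in> \<rat>" "y < z" "z < real s / real r"
      using Rats_dense_in_real[OF y(2)] by blast
    then obtain s' r' where sr': "z = real s' / real r'" "r' \<noteq> 0"
      using Rats_abs_nat_div_natE[OF z(1)] y(3) z(2) by (metis abs_of_pos order_le_less_trans)
    have pos: "0 < s'" "0 < r'" using sr' z(2) y(3) by (auto intro!: Nat.gr0I)
    have lt: "r * s' < r' * s"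
    proof -
      have "real s' * real r < real s * real r'" using z(3) sr' x(3) by (simp add: field_simps)
      then have "s' * r < s * r'" unfolding of_nat_mult[symmetric] of_nat_less_iff .
      then show ?thesis by (simp add: mult.commute)
    qed
    have big: "max (Sup (A (C i))) (Sup (A (C j))) < ennreal (real s' / real r')"
      using y(1) ennreal_leI[of y z] z(2) unfolding sr'(1)[symmetric] by (meson less_imp_le less_le_trans)
    have contained: "\<forall>\<^sub>F t in sequentially. C k (s * t) (r * t)" if k: "Sup (A (C k)) < ennreal (real s' / real r')" for k
    proof -
      have "ennreal (real s' / real r') \<notin> A (C k)" using k by (meson Sup_upper leD)
      then have "\<exists>\<^sub>F t in sequentially. C k (s' * t) (r' * t)"
        using pos unfolding A_def frequently_def by blast
      then show ?thesis using step pos lt by blast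
    qed
    have "\<forall>\<^sub>F t in sequentially. C i (s * t) (r * t) \<and> C j (s * t) (r * t)"
      using contained[of i] contained[of j] big by (simp add: eventually_conj)
    with ev have "\<forall>\<^sub>F t::nat in sequentially. False" by eventually_elim blast
    then show False by simp
  qed
qed

section \<open>Direct sums\<close>

lemma covers_cong: "(\<And>e. e \<in> E \<Longrightarrow> f e = g e) \<Longrightarrow> covers E \<B> s f \<longleftrightarrow> covers E \<B> s g"
  unfolding covers_def transversals_def
  by (intro ball_cong refl) (metis (no_types, lifting) mem_Collect_eq subsetD sum.cong)

lemma packs_joins:
  assumes "\<A> \<subseteq> Pow E1" "\<B> \<subseteq> Pow E2" "E1 \<inter> E2 = {}"
  shows "packs (joins \<A> \<B>) n f \<longleftrightarrow> packs \<A> n f \<and> packs \<B> n f"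
proof
  assume "packs (joins \<A> \<B>) n f"
  then obtain H where H: "\<forall>i<n. H i \<in> joins \<A> \<B>" "\<And>e. card {i. i < n \<and> e \<in> H i} \<le> f e"
    unfolding packs_def by blast
  from H(1) have "\<forall>i. \<exists>A B. i < n \<longrightarrow> A \<in> \<A> \<and> B \<in> \<B> \<and> H i = A \<union> B"
    unfolding joins_def by blast
  then obtain F G where FG: "\<And>i. i < n \<Longrightarrow> F i \<in> \<A> \<and> G i \<in> \<B> \<and> H i = F i \<union> G i" by metis
  have "card {i. i < n \<and> e \<in> F i} \<le> f e" "card {i. i < n \<and> e \<in> G i} \<le> f e" for e
    using FG by (intro order_trans[OF card_mono H(2)[of e]]; auto)+
  then show "packs \<A> n f \<and> packs \<B> n f" unfolding packs_def using FG by blast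
next
  assume "packs \<A> n f \<and> packs \<B> n f"
  then obtain F G where F: "\<forall>i<n. F i \<in> \<A>" "\<And>e. card {i. i < n \<and> e \<in> F i} \<le> f e"
    and G: "\<forall>i<n. G i \<in> \<B>" "\<And>e. card {i. i < n \<and> e \<in> G i} \<le> f e"
    unfolding packs_def by blast
  have "card {i. i < n \<and> e \<in> F i \<union> G i} \<le> f e" for e
  proof (cases "e \<in> E1")
    case True
    then have "{i. i < n \<and> e \<in> F i \<union> G i} = {i. i < n \<and> e \<in> F i}" using G(1) assms by blast
    then show ?thesis using F(2)[of e] by simp
  next
    case False
    then have "{i. i < n \<and> e \<in> F i \<union> G i} = {i. i < n \<and> e \<in> G i}" using F(1) assms by blast
    then show ?thesis using G(2)[of e] by simp
  qed
  then show "packs (joins \<A> \<B>) n f"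
    unfolding packs_def using F(1) G(1) by (intro exI[of _ "\<lambda>i. F i \<union> G i"]) (use joins_def in blast)
qed

lemma packs_cong:
  assumes sub: "\<B> \<subseteq> Pow E" and eq: "\<And>e. e \<in> E \<Longrightarrow> f e = g e"
  shows "packs \<B> n f \<longleftrightarrow> packs \<B> n g"
proof -
  have "card {i. i < n \<and> e \<in> F i} \<le> f e \<longleftrightarrow> card {i. i < n \<and> e \<in> F i} \<le> g e"
    if "\<forall>i<n. F i \<in> \<B>" for F e
  proof (cases "e \<in> E")
    case False
    then have "{i. i < n \<and> e \<in> F i} = {}" using that sub by blast
    then show ?thesis by (metis card.empty le0)
  qed (simp add: eq)
  then show ?thesis unfolding packs_def by blast
qed

lemma packs_joins_split:
  assumes sub: "\<A> \<subseteq> Pow E1" "\<B> \<subseteq> Pow E2" "E1 \<inter> E2 = {}"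
  shows "packs (joins \<A> \<B>) n h \<longleftrightarrow> (\<exists>f g. packs \<A> n f \<and> packs \<B> n g \<and> h = (\<lambda>e. f e + g e))"
proof
  assume "packs (joins \<A> \<B>) n h"
  then have h: "packs \<A> n h" "packs \<B> n h" by (simp_all add: packs_joins[OF sub])
  define f g where "f e = (if e \<in> E1 then h e else 0)"
    and "g e = (if e \<in> E1 then 0 else h e)" for e
  have "f e = h e" if "e \<in> E1" for e using that by (simp add: f_def)
  from packs_cong[OF sub(1) this] have "packs \<A> n f" using h(1) by simp
  moreover have "g e = h e" if "e \<in> E2" for e using that sub(3) by (auto simp: g_def)
  from packs_cong[OF sub(2) this] have "packs \<B> n g" using h(2) by simp
  moreover have "h = (\<lambda>e. f e + g e)" by (auto simp: f_def g_def)
  ultimately show "\<exists>f g. packs \<A> n f \<and> packs \<B> n g \<and> h = (\<lambda>e. f e + g e)" by blast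
next
  assume "\<exists>f g. packs \<A> n f \<and> packs \<B> n g \<and> h = (\<lambda>e. f e + g e)"
  then have "packs \<A> n h" "packs \<B> n h" by (auto elim!: packs_mono)
  then show "packs (joins \<A> \<B>) n h" by (simp add: packs_joins[OF sub])
qed

text \<open>
  If \<open>T\<close> misses some \<open>A \<in> \<A>\<close> and some \<open>B \<in> \<B>\<close>, it misses \<open>A \<union> B\<close>; so a transversal of the joins
  contains a transversal of one of the two families.
\<close>
lemma covers_joins:
  assumes "finite E1" "finite E2"
    and "\<A> \<subseteq> Pow E1" "\<B> \<subseteq> Pow E2" "E1 \<inter> E2 = {}"
  shows "covers (E1 \<union> E2) (joins \<A> \<B>) s f \<longleftrightarrow> covers E1 \<A> s f \<and> covers E2 \<B> s f"
proof
  assume c: "covers (E1 \<union> E2) (joins \<A> \<B>) s f"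
  have "T \<in> transversals (E1 \<union> E2) (joins \<A> \<B>)"
    if "T \<in> transversals E1 \<A> \<or> T \<in> transversals E2 \<B>" for T
    using that unfolding transversals_def joins_def by blast
  then show "covers E1 \<A> s f \<and> covers E2 \<B> s f" using c unfolding covers_def by blast
next
  assume c: "covers E1 \<A> s f \<and> covers E2 \<B> s f"
  show "covers (E1 \<union> E2) (joins \<A> \<B>) s f"
    unfolding covers_def
  proof
    fix T assume T: "T \<in> transversals (E1 \<union> E2) (joins \<A> \<B>)"
    then have fin: "finite T" using assms(1,2) unfolding transversals_def
      by (auto intro: finite_subset)
    have "T \<inter> E1 \<in> transversals E1 \<A> \<or> T \<inter> E2 \<in> transversals E2 \<B>"
    proof (rule ccontr)
      assume "\<not> ?thesis"
      then obtain A B where "A \<in> \<A>" "A \<inter> (T \<inter> E1) = {}" "B \<in> \<B>" "B \<inter> (T \<inter> E2) = {}"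
        unfolding transversals_def by blast
      moreover from this have "(A \<union> B) \<inter> T \<noteq> {}" using T unfolding transversals_def joins_def by blast
      ultimately show False using assms(3,4) by blast
    qed
    then have "s \<le> sum f (T \<inter> E1) \<or> s \<le> sum f (T \<inter> E2)" using c unfolding covers_def by blast
    moreover have "sum f (T \<inter> E1) \<le> sum f T" "sum f (T \<inter> E2) \<le> sum f T"
      using fin by (auto intro!: sum_mono2)
    ultimately show "s \<le> sum f T" by linarith
  qed
qed

lemma covers_const:
  assumes "finite E" "\<B> \<noteq> {}"
  shows "covers E \<B> s (\<lambda>_. s)"
  unfolding covers_def
proof
  fix T assume T: "T \<in> transversals E \<B>"
  then have "T \<noteq> {}" "finite T" using assms unfolding transversals_def by (auto intro: finite_subset)
  then have "1 \<le> card T" by (simp add: Suc_le_eq card_gt_0_iff)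
  then show "s \<le> (\<Sum>_\<in>T. s)" by simp
qed

text \<open>
  Covers of the two families can be glued along the disjoint ground sets; for the forward
  direction each cover needs a partner on the other side, which the constant vector \<open>s\<close> provides.
\<close>
lemma contained_joins:
  assumes "finite E1" "finite E2" "\<A> \<noteq> {}" "\<B> \<noteq> {}"
    and sub: "\<A> \<subseteq> Pow E1" "\<B> \<subseteq> Pow E2" "E1 \<inter> E2 = {}"
  shows "contained (E1 \<union> E2) (joins \<A> \<B>) s n \<longleftrightarrow> contained E1 \<A> s n \<and> contained E2 \<B> s n"
proof
  note cov = covers_joins[OF assms(1,2) sub] and pk = packs_joins[OF sub]
  assume c: "contained (E1 \<union> E2) (joins \<A> \<B>) s n"
  have pack: "packs \<A> n f \<and> packs \<B> n g" if "covers E1 \<A> s f" "covers E2 \<B> s g" for f g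
  proof -
    define h where "h e = (if e \<in> E1 then f e else g e)" for e
    have h: "h e = f e" if "e \<in> E1" for e using that by (simp add: h_def)
    have h': "h e = g e" if "e \<in> E2" for e using that sub(3) by (auto simp: h_def)
    have "covers E1 \<A> s h" "covers E2 \<B> s h"
      using that by (simp_all add: covers_cong[OF h] covers_cong[OF h'])
    then have "packs \<A> n h" "packs \<B> n h" using c cov pk unfolding contained_def by blast+
    then show ?thesis by (simp add: packs_cong[OF sub(1) h] packs_cong[OF sub(2) h'])
  qed
  then show "contained E1 \<A> s n \<and> contained E2 \<B> s n"
    using pack[OF _ covers_const[OF assms(2,4)]] pack[OF covers_const[OF assms(1,3)]]
    unfolding contained_def by simp
next
  assume "contained E1 \<A> s n \<and> contained E2 \<B> s n"
  then show "contained (E1 \<union> E2) (joins \<A> \<B>) s n"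
    by (simp add: contained_def covers_joins[OF assms(1,2) sub] packs_joins[OF sub])
qed

section \<open>Least weights of covers and their growth\<close>

lemma least_weight_attained:
  assumes "finite E" "\<B> \<noteq> {}"
  shows "\<exists>f. covers E \<B> s f \<and> sum f E = least_weight E \<B> s"
  unfolding least_weight_def using covers_const[OF assms, of s]
  by (intro LeastI_ex[of "\<lambda>d. \<exists>f. covers E \<B> s f \<and> sum f E = d"]) blast

lemma least_weight_le: "covers E \<B> s f \<Longrightarrow> least_weight E \<B> s \<le> sum f E"
  unfolding least_weight_def by (rule Least_le) blast

lemma least_weight_joins:
  assumes "finite E1" "finite E2" "\<A> \<noteq> {}" "\<B> \<noteq> {}"
    and sub: "\<A> \<subseteq> Pow E1" "\<B> \<subseteq> Pow E2" "E1 \<inter> E2 = {}"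
  shows "least_weight (E1 \<union> E2) (joins \<A> \<B>) s = least_weight E1 \<A> s + least_weight E2 \<B> s"
proof (rule antisym)
  note cov = covers_joins[OF assms(1,2) sub]
  obtain f g where f: "covers E1 \<A> s f" "sum f E1 = least_weight E1 \<A> s"
    and g: "covers E2 \<B> s g" "sum g E2 = least_weight E2 \<B> s"
    using least_weight_attained assms by metis
  define h where "h e = (if e \<in> E1 then f e else g e)" for e
  have h: "h e = f e" if "e \<in> E1" for e using that by (simp add: h_def)
  have h': "h e = g e" if "e \<in> E2" for e using that sub(3) by (auto simp: h_def)
  have "covers (E1 \<union> E2) (joins \<A> \<B>) s h"
    using f(1) g(1) by (simp add: cov covers_cong[OF h] covers_cong[OF h'])
  from least_weight_le[OF this] have "least_weight (E1 \<union> E2) (joins \<A> \<B>) s \<le> sum h E1 + sum h E2"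
    using assms by (simp add: sum.union_disjoint)
  also have "sum h E1 = sum f E1" by (intro sum.cong refl h)
  also have "sum h E2 = sum g E2" by (intro sum.cong refl h')
  finally show "least_weight (E1 \<union> E2) (joins \<A> \<B>) s \<le> least_weight E1 \<A> s + least_weight E2 \<B> s"
    using f g by simp
  have "joins \<A> \<B> \<noteq> {}" using assms(3,4) unfolding joins_def by blast
  then obtain k where k: "covers (E1 \<union> E2) (joins \<A> \<B>) s k"
      "sum k (E1 \<union> E2) = least_weight (E1 \<union> E2) (joins \<A> \<B>) s"
    using least_weight_attained[of "E1 \<union> E2" "joins \<A> \<B>"] assms(1,2) by blast
  then have "least_weight E1 \<A> s \<le> sum k E1" "least_weight E2 \<B> s \<le> sum k E2"
    using cov least_weight_le by blast+
  then show "least_weight E1 \<A> s + least_weight E2 \<B> s \<le> least_weight (E1 \<union> E2) (joins \<A> \<B>) s"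
    using k(2) assms by (simp add: sum.union_disjoint)
qed

lemma least_weight_subadditive:
  assumes "finite E" "\<B> \<noteq> {}"
  shows "least_weight E \<B> (s + t) \<le> least_weight E \<B> s + least_weight E \<B> t"
proof -
  obtain f g where f: "covers E \<B> s f" "sum f E = least_weight E \<B> s"
    and g: "covers E \<B> t g" "sum g E = least_weight E \<B> t"
    using least_weight_attained assms by metis
  have "covers E \<B> (s + t) (\<lambda>e. f e + g e)"
    using f(1) g(1) unfolding covers_def by (auto simp: sum.distrib intro: add_mono)
  from least_weight_le[OF this] show ?thesis using f g by (simp add: sum.distrib)
qed

text \<open>
  Fekete's lemma: writing \<open>n = q k + r\<close> with \<open>r < k\<close> bounds \<open>a n / n\<close> by \<open>a k / k\<close> plus an error
  of order \<open>1 / n\<close>, so the quotients converge to their infimum.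
\<close>
lemma subadditive_quotient_convergent:
  fixes a :: "nat \<Rightarrow> nat"
  assumes sub: "\<And>m n. a (m + n) \<le> a m + a n"
  shows "convergent (\<lambda>n. real (a n) / real n)"
proof -
  define L where "L = (INF n\<in>{1..}. real (a n) / real n)"
  have bdd: "bdd_below ((\<lambda>n. real (a n) / real n) ` {1..})"
    by (rule bdd_belowI[of _ 0]) auto
  have lower: "L \<le> real (a n) / real n" if "1 \<le> n" for n
    unfolding L_def using bdd that by (intro cINF_lower) auto
  have mult: "a (q * k) \<le> a 0 + q * a k" for q k
  proof (induction q)
    case (Suc q)
    then show ?case using sub[of k "q * k"] by simp
  qed simp
  have "(\<lambda>n. real (a n) / real n) \<longlonglongrightarrow> L"
  proof (rule LIMSEQ_I)
    fix \<epsilon> :: real assume \<epsilon>: "0 < \<epsilon>"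
    have "\<exists>k\<in>{1..}. real (a k) / real k < L + \<epsilon> / 2"
      using cINF_less_iff[OF _ bdd, of "L + \<epsilon> / 2"] \<epsilon> unfolding L_def by simp
    then obtain k where k: "1 \<le> k" "real (a k) / real k < L + \<epsilon> / 2" by auto
    define M where "M = a 0 + Max (a ` {..<k})"
    have upper: "real (a n) / real n \<le> real (a k) / real k + real M / real n" if n: "1 \<le> n" for n
    proof -
      have "a n = a (n div k * k + n mod k)" by simp
      also have "\<dots> \<le> a (n div k * k) + a (n mod k)" by (rule sub)
      also have "a (n mod k) \<le> Max (a ` {..<k})" using k(1) by (intro Max_ge) auto
      also have "a (n div k * k) \<le> a 0 + n div k * a k" by (rule mult)
      finally have "real (a n) \<le> real (n div k * a k + M)" unfolding M_def of_nat_le_iff by simp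
      also have "\<dots> \<le> real n / real k * real (a k) + real M"
        using mult_right_mono[OF of_nat_div_le_of_nat[of n k], of "real (a k)"] by simp
      finally have "real (a n) / real n \<le> (real n / real k * real (a k) + real M) / real n"
        by (rule divide_right_mono) simp
      also have "\<dots> = real (a k) / real k + real M / real n" using n k(1) by (simp add: field_simps)
      finally show ?thesis .
    qed
    obtain N where N: "real M < real N * (\<epsilon> / 2)" using ex_less_of_nat_mult[of "\<epsilon> / 2" "real M"] \<epsilon> by auto
    have "norm (real (a n) / real n - L) < \<epsilon>" if n: "max 1 N \<le> n" for n
    proof -
      have "real N * (\<epsilon> / 2) \<le> real n * (\<epsilon> / 2)" using n \<epsilon> by (intro mult_right_mono) auto
      with N have "real M < real n * (\<epsilon> / 2)" by linarith
      then have "real M / real n < \<epsilon> / 2" using n by (simp add: field_simps)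
      moreover have "1 \<le> n" using n by simp
      ultimately show ?thesis
        using upper[of n] lower[of n] k(2) unfolding real_norm_def by linarith
    qed
    then show "\<exists>N. \<forall>n\<ge>N. norm (real (a n) / real n - L) < \<epsilon>" by blast
  qed
  then show ?thesis by (rule convergentI)
qed

section \<open>Ideals spanned by monomials\<close>

text \<open>
  Membership of monomials is given by a predicate on plain functions, not on finitely supported
  ones, so that it can be \<open>packs\<close> or \<open>covers\<close> directly; \<open>E\<close> bounds the variables that occur. The
  span is an ideal of \<open>poly_ring E\<close> when the predicate is monotone.
\<close>

definition monomial_span :: "'a set \<Rightarrow> (('a \<Rightarrow> nat) \<Rightarrow> bool) \<Rightarrow> ('a, 'k::field) mpoly set" where
  "monomial_span E Q =
     {p. \<forall>m\<in>Poly_Mapping.keys p. Poly_Mapping.keys m \<subseteq> E \<and> Q (Poly_Mapping.lookup m)}"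

lemma poly_ring_simps [simp]:
  "carrier (poly_ring E) = monomial_span E (\<lambda>_. True)"
  "mult (poly_ring E) = (*)" "one (poly_ring E) = 1"
  "zero (poly_ring E) = 0" "add (poly_ring E) = (+)"
  by (simp_all add: poly_ring_def monomial_span_def)

lemma poly_ring_ring: "ring (poly_ring E :: ('a, 'k::field) mpoly ring)"
  using poly_ring_cring by (rule cring.axioms(1))

lemma keys_add_nat:
  fixes a b :: "'a \<Rightarrow>\<^sub>0 nat"
  shows "Poly_Mapping.keys (a + b) = Poly_Mapping.keys a \<union> Poly_Mapping.keys b"
  by (auto simp: in_keys_iff lookup_add)

lemma single_mem_monomial_span:
  "c \<noteq> 0 \<Longrightarrow> Poly_Mapping.single m c \<in> monomial_span E Q \<longleftrightarrow>
     Poly_Mapping.keys m \<subseteq> E \<and> Q (Poly_Mapping.lookup m)"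
  by (simp add: monomial_span_def)

lemma monomial_span_mono:
  "E \<subseteq> E' \<Longrightarrow> (\<And>f. Q f \<Longrightarrow> Q' f) \<Longrightarrow> monomial_span E Q \<subseteq> monomial_span E' Q'"
  unfolding monomial_span_def by blast

lemma monomial_span_add:
  "p \<in> monomial_span E Q \<Longrightarrow> q \<in> monomial_span E Q \<Longrightarrow> p + q \<in> monomial_span E Q"
  using Poly_Mapping.keys_add[of p q] unfolding monomial_span_def by blast

lemma monomial_span_mult:
  assumes p: "p \<in> monomial_span E P" and q: "q \<in> monomial_span E Q"
    and PQ: "\<And>f g. P f \<Longrightarrow> Q g \<Longrightarrow> R (\<lambda>e. f e + g e)"
  shows "p * q \<in> monomial_span E R"
  unfolding monomial_span_def
proof (intro CollectI ballI)
  fix m assume "m \<in> Poly_Mapping.keys (p * q)"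
  then obtain a b where ab: "m = a + b" "a \<in> Poly_Mapping.keys p" "b \<in> Poly_Mapping.keys q"
    using Poly_Mapping.keys_mult[of p q] by blast
  then have a: "Poly_Mapping.keys a \<subseteq> E" "P (Poly_Mapping.lookup a)"
    and b: "Poly_Mapping.keys b \<subseteq> E" "Q (Poly_Mapping.lookup b)"
    using p q by (auto simp: monomial_span_def)
  have "Poly_Mapping.lookup m = (\<lambda>e. Poly_Mapping.lookup a e + Poly_Mapping.lookup b e)"
    by (simp add: ab(1) lookup_add fun_eq_iff)
  then show "Poly_Mapping.keys m \<subseteq> E \<and> R (Poly_Mapping.lookup m)"
    using a b PQ by (simp add: ab(1) keys_add_nat)
qed

lemma mono_add_left:
  fixes f g :: "'a \<Rightarrow> nat"
  assumes "mono Q" "Q g"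
  shows "Q (\<lambda>e. f e + g e)"
  using monoD[OF assms(1), of g "\<lambda>e. f e + g e"] assms(2) by (auto simp: le_fun_def)

lemma monomial_span_ideal:
  assumes "mono Q"
  shows "ideal (monomial_span E Q :: ('a, 'k::field) mpoly set) (poly_ring E)"
proof (rule idealI)
  let ?R = "poly_ring E :: ('a, 'k) mpoly ring" and ?I = "monomial_span E Q :: ('a, 'k) mpoly set"
  interpret ring ?R by (rule poly_ring_ring)
  show "ring ?R" by (rule ring_axioms)
  have sub: "?I \<subseteq> carrier ?R" by (simp add: monomial_span_mono)
  have uminus: "- p \<in> monomial_span E P" if "p \<in> monomial_span E P" for p :: "('a, 'k) mpoly" and P
    using that by (simp add: monomial_span_def)
  show "subgroup ?I (add_monoid ?R)"
  proof (rule subgroup.intro)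
    show "?I \<subseteq> carrier (add_monoid ?R)" using sub by simp
    show "p \<otimes>\<^bsub>add_monoid ?R\<^esub> q \<in> ?I" if "p \<in> ?I" "q \<in> ?I" for p q
      using monomial_span_add[OF that] by simp
    show "\<one>\<^bsub>add_monoid ?R\<^esub> \<in> ?I" by (simp add: monomial_span_def)
    fix p assume p: "p \<in> ?I"
    have "\<ominus>\<^bsub>?R\<^esub> p = - p" using p sub by (intro minus_equality) (auto intro: uminus)
    then show "inv\<^bsub>add_monoid ?R\<^esub> p \<in> ?I" using uminus[OF p] by (simp add: a_inv_def)
  qed
  show "x \<otimes>\<^bsub>?R\<^esub> a \<in> ?I" if "a \<in> ?I" "x \<in> carrier ?R" for a x
    using monomial_span_mult[of x E "\<lambda>_. True" a Q Q] that mono_add_left[OF assms] by simp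
  then show "a \<otimes>\<^bsub>?R\<^esub> x \<in> ?I" if "a \<in> ?I" "x \<in> carrier ?R" for a x
    using that by (simp add: mult.commute)
qed

lemma poly_mapping_sum_single:
  "p = (\<Sum>m\<in>Poly_Mapping.keys p. Poly_Mapping.single m (Poly_Mapping.lookup p m))"
proof (rule poly_mapping_eqI)
  fix k
  show "Poly_Mapping.lookup p k =
      Poly_Mapping.lookup (\<Sum>m\<in>Poly_Mapping.keys p. Poly_Mapping.single m (Poly_Mapping.lookup p m)) k"
    by (simp add: lookup_sum lookup_single when_def in_keys_iff)
qed

lemma monomial_span_subset_ideal:
  fixes J :: "('a, 'k::field) mpoly set"
  assumes J: "ideal J (poly_ring E)"
    and mon: "\<And>m. Poly_Mapping.keys m \<subseteq> E \<Longrightarrow> Q (Poly_Mapping.lookup m) \<Longrightarrow> Poly_Mapping.single m 1 \<in> J"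
  shows "monomial_span E Q \<subseteq> J"
proof
  interpret ideal J "poly_ring E" by fact
  fix p :: "('a, 'k) mpoly" assume p: "p \<in> monomial_span E Q"
  have single: "Poly_Mapping.single m (Poly_Mapping.lookup p m) \<in> J" if "m \<in> Poly_Mapping.keys p" for m
  proof -
    have "Poly_Mapping.single m 1 \<in> J" using p that by (intro mon) (auto simp: monomial_span_def)
    moreover have "Poly_Mapping.single 0 (Poly_Mapping.lookup p m) \<in> carrier (poly_ring E)"
      by (simp add: monomial_span_def)
    ultimately have "Poly_Mapping.single 0 (Poly_Mapping.lookup p m) * Poly_Mapping.single m 1 \<in> J"
      using I_l_closed[of "Poly_Mapping.single m 1"] by simp
    then show ?thesis by (simp add: mult_single)
  qed
  have "(\<Sum>m\<in>K. Poly_Mapping.single m (Poly_Mapping.lookup p m)) \<in> J"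
    if "finite K" "K \<subseteq> Poly_Mapping.keys p" for K
    using that
  proof (induction K rule: finite_induct)
    case empty
    then show ?case using additive_subgroup.zero_closed[OF additive_subgroup_axioms] by simp
  next
    case (insert x K)
    then show ?case
      using additive_subgroup.a_closed[OF additive_subgroup_axioms single[of x]] by simp
  qed
  from this[of "Poly_Mapping.keys p"] show "p \<in> J" by (simp flip: poly_mapping_sum_single)
qed

lemma monomial_of_exponents:
  fixes f :: "'a \<Rightarrow> nat"
  assumes "finite A" "\<And>e. f e \<noteq> 0 \<Longrightarrow> e \<in> A"
  obtains m where "Poly_Mapping.lookup m = f" "Poly_Mapping.keys m \<subseteq> A"
proof -
  have "finite {e. f e \<noteq> 0}" using assms by (auto intro: finite_subset)
  then have "Poly_Mapping.lookup (Abs_poly_mapping f) = f" by simp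
  then show ?thesis using assms(2) by (intro that[of "Abs_poly_mapping f"]) (auto simp: in_keys_iff)
qed

lemma ideal_prod_monomial_span:
  assumes P: "mono P" and Q: "mono Q"
  shows "ideal_prod (poly_ring E) (monomial_span E P) (monomial_span E Q :: ('a, 'k::field) mpoly set) =
    monomial_span E (\<lambda>h. \<exists>f g. P f \<and> Q g \<and> h = (\<lambda>e. f e + g e))" (is "?L = monomial_span E ?PQ")
proof
  interpret ring "poly_ring E :: ('a, 'k) mpoly ring" by (rule poly_ring_ring)
  show "?L \<subseteq> monomial_span E ?PQ"
  proof
    fix p assume "p \<in> ?L"
    then show "p \<in> monomial_span E ?PQ"
    proof induction
      case (prod i j)
      have "i * j \<in> monomial_span E ?PQ" by (rule monomial_span_mult[OF prod]) blast
      then show ?case by simp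
    next
      case (sum p q)
      then show ?case using monomial_span_add by simp
    qed
  qed
  show "monomial_span E ?PQ \<subseteq> ?L"
  proof (rule monomial_span_subset_ideal)
    show "ideal ?L (poly_ring E)"
      using P Q by (intro ideal_prod_is_ideal monomial_span_ideal)
    fix m assume m: "Poly_Mapping.keys m \<subseteq> E" "?PQ (Poly_Mapping.lookup m)"
    then obtain f g where fg: "P f" "Q g" "Poly_Mapping.lookup m = (\<lambda>e. f e + g e)" by blast
    have keys: "e \<in> Poly_Mapping.keys m" if "f e \<noteq> 0 \<or> g e \<noteq> 0" for e
      using that fg(3) by (auto simp: in_keys_iff)
    obtain a where a: "Poly_Mapping.lookup a = f" "Poly_Mapping.keys a \<subseteq> Poly_Mapping.keys m"
      using monomial_of_exponents[OF finite_keys, of f m] keys by blast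
    obtain b where b: "Poly_Mapping.lookup b = g" "Poly_Mapping.keys b \<subseteq> Poly_Mapping.keys m"
      using monomial_of_exponents[OF finite_keys, of g m] keys by blast
    have mab: "m = a + b" by (rule poly_mapping_eqI) (simp add: lookup_add a b fg)
    have "Poly_Mapping.single a 1 \<in> monomial_span E P" "Poly_Mapping.single b 1 \<in> monomial_span E Q"
      using a b m(1) fg by (auto simp: single_mem_monomial_span)
    from ideal_prod.prod[OF this, of "poly_ring E"] show "Poly_Mapping.single m 1 \<in> ?L"
      by (simp add: mult_single mab)
  qed
qed

text \<open>
  The recursion for \<open>Q\<close> expresses that the exponents admitted by \<open>Q (n + 1)\<close> are the sums of
  those admitted by \<open>Q n\<close> and by \<open>Q 1\<close>; it is shared by powers of facet ideals and of monomial primes.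
\<close>
lemma monomial_span_power:
  assumes mono: "\<And>n. mono (Q n)" and zero: "\<And>f. Q 0 f"
    and step: "\<And>n h. Q (Suc n) h \<longleftrightarrow> (\<exists>f g. Q n f \<and> Q 1 g \<and> h = (\<lambda>e. f e + g e))"
  shows "monomial_span E (Q 1) [^]\<^bsub>ideals_set (poly_ring E)\<^esub> n =
    (monomial_span E (Q n) :: ('a, 'k::field) mpoly set)"
proof (induction n)
  case 0
  then show ?case by (simp add: ideals_set_def zero)
next
  case (Suc n)
  have "Q (Suc n) = (\<lambda>h. \<exists>f g. Q n f \<and> Q 1 g \<and> h = (\<lambda>e. f e + g e))"
    using step[of n] by (rule ext)
  then show ?case using Suc.IH ideal_prod_monomial_span[OF mono mono, of E n 1]
    by (simp add: ideals_set_def)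
qed

section \<open>Ideals generated by squarefree monomials\<close>

lemma prod_pvar:
  "finite B \<Longrightarrow> (\<Prod>e\<in>B. pvar e :: ('a, 'k::field) mpoly) =
     Poly_Mapping.single (\<Sum>e\<in>B. Poly_Mapping.single e 1) 1"
  by (induction B rule: finite_induct) (simp_all add: pvar_def mult_single)

lemma lookup_sum_single:
  "finite B \<Longrightarrow> Poly_Mapping.lookup (\<Sum>e\<in>B. Poly_Mapping.single e (1::nat)) x = (if x \<in> B then 1 else 0)"
  by (simp add: lookup_sum lookup_single when_def)

lemma mono_packs: "mono (packs \<B> n)"
  by (intro monoI le_boolI) (auto elim!: packs_mono simp: le_fun_def)

lemma genideal_squarefree_monomials:
  assumes E: "finite E" "\<B> \<subseteq> Pow E"
  shows "genideal (poly_ring E) {\<Prod>e\<in>B. pvar e | B. B \<in> \<B>} =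
    (monomial_span E (packs \<B> 1) :: ('a, 'k::field) mpoly set)" (is "genideal ?R ?G = ?I")
proof
  interpret ring "?R :: ('a, 'k) mpoly ring" by (rule poly_ring_ring)
  define v :: "'a set \<Rightarrow> 'a \<Rightarrow>\<^sub>0 nat" where "v B = (\<Sum>e\<in>B. Poly_Mapping.single e 1)" for B
  have fin: "finite B" if "B \<in> \<B>" for B using E that finite_subset by blast
  have v: "Poly_Mapping.lookup (v B) e = (if e \<in> B then 1 else 0)" if "B \<in> \<B>" for B e
    unfolding v_def lookup_sum_single[OF fin[OF that]] ..
  have prod: "(\<Prod>e\<in>B. pvar e) = (Poly_Mapping.single (v B) 1 :: ('a, 'k) mpoly)" if "B \<in> \<B>" for B
    using fin[OF that] by (simp add: v_def prod_pvar)
  have keys: "Poly_Mapping.keys (v B) \<subseteq> E" if "B \<in> \<B>" for B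
    using v[OF that] PowD[OF subsetD[OF E(2) that]] by (auto simp: in_keys_iff split: if_splits)
  have GI: "?G \<subseteq> ?I"
  proof
    fix p :: "('a, 'k) mpoly" assume "p \<in> ?G"
    then obtain B where B: "B \<in> \<B>" "p = (\<Prod>e\<in>B. pvar e)" by blast
    have "packs \<B> 1 (Poly_Mapping.lookup (v B))"
      unfolding packs_1 using B(1) v by (intro bexI[of _ B]) auto
    then show "p \<in> ?I" using B prod keys by (simp add: single_mem_monomial_span)
  qed
  then show "genideal ?R ?G \<subseteq> ?I" by (intro genideal_minimal monomial_span_ideal mono_packs)
  have carr: "?G \<subseteq> carrier ?R" using GI by (rule order_trans) (simp add: monomial_span_mono)
  then interpret I: ideal "genideal ?R ?G" ?R by (rule genideal_ideal)
  show "?I \<subseteq> genideal ?R ?G"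
  proof (rule monomial_span_subset_ideal[OF I.is_ideal])
    fix m assume m: "Poly_Mapping.keys m \<subseteq> E" "packs \<B> 1 (Poly_Mapping.lookup m)"
    then obtain B where B: "B \<in> \<B>" "\<And>e. e \<in> B \<Longrightarrow> 1 \<le> Poly_Mapping.lookup m e"
      unfolding packs_1 by blast
    have mv: "m = (m - v B) + v B"
    proof (rule poly_mapping_eqI)
      fix e show "Poly_Mapping.lookup m e = Poly_Mapping.lookup (m - v B + v B) e"
        using B v[of B e] by (auto simp: lookup_add lookup_minus)
    qed
    have "Poly_Mapping.keys (m - v B) \<subseteq> E"
      using m(1) mv keys_add_nat[of "m - v B" "v B"] by simp
    then have "(Poly_Mapping.single (m - v B) 1 :: ('a, 'k) mpoly) \<in> carrier ?R"
      by (simp add: single_mem_monomial_span)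
    moreover have "Poly_Mapping.single (v B) 1 \<in> genideal ?R ?G"
      using B(1) prod genideal_self[OF carr] by force
    ultimately have "Poly_Mapping.single (m - v B) 1 * Poly_Mapping.single (v B) 1 \<in> genideal ?R ?G"
      using I.I_l_closed[of "Poly_Mapping.single (v B) 1"] by simp
    then show "Poly_Mapping.single m 1 \<in> genideal ?R ?G" by (simp add: mult_single flip: mv)
  qed
qed

lemma genideal_extension:
  assumes E: "finite E" "E' \<subseteq> E" "\<B> \<subseteq> Pow E'"
  shows "genideal (poly_ring E) (monomial_span E' (packs \<B> 1)) =
    (monomial_span E (packs \<B> 1) :: ('a, 'k::field) mpoly set)" (is "genideal ?R ?I' = ?I")
proof
  interpret ring "?R :: ('a, 'k) mpoly ring" by (rule poly_ring_ring)
  have sub: "?I' \<subseteq> ?I" using E(2) by (rule monomial_span_mono)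
  then show "genideal ?R ?I' \<subseteq> ?I" by (intro genideal_minimal monomial_span_ideal mono_packs)
  have carr: "?I' \<subseteq> carrier ?R" using E(2) by (simp add: monomial_span_mono)
  have E': "finite E'" using E finite_subset by blast
  have "?I = genideal ?R {\<Prod>e\<in>B. pvar e | B. B \<in> \<B>}"
    using E by (intro genideal_squarefree_monomials[symmetric]) blast+
  also have "\<dots> \<subseteq> genideal ?R ?I'"
  proof (rule genideal_minimal[OF genideal_ideal[OF carr]])
    have "(\<Prod>e\<in>B. pvar e) \<in> ?I'" if "B \<in> \<B>" for B
    proof -
      have "finite B" using that E(3) E' finite_subset by blast
      moreover have "Poly_Mapping.keys (\<Sum>e\<in>B. Poly_Mapping.single e (1::nat)) \<subseteq> E'"
        using lookup_sum_single[OF \<open>finite B\<close>] PowD[OF subsetD[OF E(3) that]] by (auto simp: in_keys_iff split: if_splits)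
      moreover have "packs \<B> 1 (Poly_Mapping.lookup (\<Sum>e\<in>B. Poly_Mapping.single e (1::nat)))"
        unfolding packs_1 using that lookup_sum_single[OF \<open>finite B\<close>] by (intro bexI[of _ B]) auto
      ultimately show ?thesis by (simp add: prod_pvar single_mem_monomial_span)
    qed
    then show "{\<Prod>e\<in>B. pvar e | B. B \<in> \<B>} \<subseteq> genideal ?R ?I'"
      using genideal_self[OF carr] by blast
  qed
  finally show "?I \<subseteq> genideal ?R ?I'" .
qed

section \<open>Monomial primes\<close>

text \<open>
  This replaces the comparison of leading monomials under a term order, for which the variables
  would have to be ordered. The coordinates in \<open>E\<close> are maximised one after the other: a sum of
  elements with maximal \<open>x\<close>-coordinate can only arise from two such elements, so passing to
  these subsets loses no representation, and they agree in one more coordinate.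
\<close>

lemma unique_sum:
  fixes K L :: "('a \<Rightarrow>\<^sub>0 nat) set"
  assumes "finite E" "finite K" "K \<noteq> {}" "finite L" "L \<noteq> {}"
    and "\<And>a a' e. a \<in> K \<Longrightarrow> a' \<in> K \<Longrightarrow> e \<notin> E \<Longrightarrow> Poly_Mapping.lookup a e = Poly_Mapping.lookup a' e"
    and "\<And>b b' e. b \<in> L \<Longrightarrow> b' \<in> L \<Longrightarrow> e \<notin> E \<Longrightarrow> Poly_Mapping.lookup b e = Poly_Mapping.lookup b' e"
  shows "\<exists>a\<in>K. \<exists>b\<in>L. \<forall>a'\<in>K. \<forall>b'\<in>L. a' + b' = a + b \<longrightarrow> a' = a \<and> b' = b"
  using assms
proof (induction E arbitrary: K L rule: finite_induct)
  case empty
  have "a = a'" if "a \<in> K" "a' \<in> K" for a a'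
    using empty.prems(5)[OF that] by (intro poly_mapping_eqI) simp
  moreover have "b = b'" if "b \<in> L" "b' \<in> L" for b b'
    using empty.prems(6)[OF that] by (intro poly_mapping_eqI) simp
  moreover obtain a b where "a \<in> K" "b \<in> L" using empty.prems(2,4) by blast
  ultimately show ?case by (intro bexI[of _ a] bexI[of _ b]) simp_all
next
  case (insert x E)
  define top where "top S = {a \<in> S. Poly_Mapping.lookup a x = Max ((\<lambda>a. Poly_Mapping.lookup a x) ` S)}"
    for S :: "('a \<Rightarrow>\<^sub>0 nat) set"
  have top_le: "Poly_Mapping.lookup a x \<le> Max ((\<lambda>a. Poly_Mapping.lookup a x) ` S)"
    if "finite S" "a \<in> S" for a and S :: "('a \<Rightarrow>\<^sub>0 nat) set"
    using that by (intro Max_ge) auto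
  have top_ne: "top S \<noteq> {}" if "finite S" "S \<noteq> {}" for S
  proof -
    have "Max ((\<lambda>a. Poly_Mapping.lookup a x) ` S) \<in> (\<lambda>a. Poly_Mapping.lookup a x) ` S"
      using that by (intro Max_in) auto
    then obtain a where "a \<in> S" "Poly_Mapping.lookup a x = Max ((\<lambda>a. Poly_Mapping.lookup a x) ` S)"
      by (elim imageE) simp
    then show ?thesis unfolding top_def by blast
  qed
  have "\<exists>a\<in>top K. \<exists>b\<in>top L. \<forall>a'\<in>top K. \<forall>b'\<in>top L. a' + b' = a + b \<longrightarrow> a' = a \<and> b' = b"
  proof (rule insert.IH)
    show "top K \<noteq> {}" "top L \<noteq> {}" using top_ne insert.prems by auto
    show "finite (top K)" "finite (top L)" using insert.prems by (auto simp: top_def)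
    show "Poly_Mapping.lookup a e = Poly_Mapping.lookup a' e"
      if "a \<in> top K" "a' \<in> top K" "e \<notin> E" for a a' e
      using that insert.prems(5)[of a a' e] by (cases "e = x") (auto simp: top_def)
    show "Poly_Mapping.lookup b e = Poly_Mapping.lookup b' e"
      if "b \<in> top L" "b' \<in> top L" "e \<notin> E" for b b' e
      using that insert.prems(6)[of b b' e] by (cases "e = x") (auto simp: top_def)
  qed
  then obtain a b where ab: "a \<in> top K" "b \<in> top L"
    and uniq: "\<And>a' b'. a' \<in> top K \<Longrightarrow> b' \<in> top L \<Longrightarrow> a' + b' = a + b \<Longrightarrow> a' = a \<and> b' = b"
    by blast
  have "a' = a \<and> b' = b" if "a' \<in> K" "b' \<in> L" and eq: "a' + b' = a + b" for a' b'
  proof (rule uniq[OF _ _ eq])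
    have "Poly_Mapping.lookup a' x + Poly_Mapping.lookup b' x = Poly_Mapping.lookup a x + Poly_Mapping.lookup b x"
      using eq by (metis lookup_add)
    moreover have "Poly_Mapping.lookup a' x \<le> Poly_Mapping.lookup a x"
      using top_le[of K a'] that(1) insert.prems(1) ab(1) by (simp add: top_def)
    moreover have "Poly_Mapping.lookup b' x \<le> Poly_Mapping.lookup b x"
      using top_le[of L b'] that(2) insert.prems(3) ab(2) by (simp add: top_def)
    ultimately show "a' \<in> top K" "b' \<in> top L" using that ab by (auto simp: top_def)
  qed
  then show ?case using ab unfolding top_def by blast
qed

lemma lookup_mult_unique:
  fixes p q :: "('a, 'k::field) mpoly"
  assumes a: "a \<in> Poly_Mapping.keys p" and b: "b \<in> Poly_Mapping.keys q"
    and uniq: "\<And>a' b'. a' \<in> Poly_Mapping.keys p \<Longrightarrow> b' \<in> Poly_Mapping.keys q \<Longrightarrow> a' + b' = a + b \<Longrightarrow>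
      a' = a \<and> b' = b"
  shows "Poly_Mapping.lookup (p * q) (a + b) = Poly_Mapping.lookup p a * Poly_Mapping.lookup q b"
proof -
  let ?c = "\<lambda>a' b'. Poly_Mapping.lookup p a' * Poly_Mapping.lookup q b'"
  have "p * q = (\<Sum>a'\<in>Poly_Mapping.keys p. Poly_Mapping.single a' (Poly_Mapping.lookup p a')) *
      (\<Sum>b'\<in>Poly_Mapping.keys q. Poly_Mapping.single b' (Poly_Mapping.lookup q b'))"
    using poly_mapping_sum_single[of p] poly_mapping_sum_single[of q] by simp
  also have "\<dots> = (\<Sum>a'\<in>Poly_Mapping.keys p. \<Sum>b'\<in>Poly_Mapping.keys q. Poly_Mapping.single (a' + b') (?c a' b'))"
    by (simp add: sum_product mult_single)
  finally have "Poly_Mapping.lookup (p * q) (a + b) =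
      (\<Sum>a'\<in>Poly_Mapping.keys p. \<Sum>b'\<in>Poly_Mapping.keys q. if a' + b' = a + b then ?c a' b' else 0)"
    by (simp add: lookup_sum lookup_single when_def)
  also have "\<dots> = (\<Sum>a'\<in>Poly_Mapping.keys p. \<Sum>b'\<in>Poly_Mapping.keys q.
      if b' = b then (if a' = a then ?c a' b' else 0) else 0)"
    using uniq by (intro sum.cong refl) auto
  also have "\<dots> = ?c a b" using a b by simp
  finally show ?thesis .
qed

lemma mono_sum: "finite T \<Longrightarrow> mono (\<lambda>f. (s::nat) \<le> sum f T)"
  by (intro monoI le_boolI) (meson le_funD order_trans sum_mono)

text \<open>
  If neither \<open>p\<close> nor \<open>q\<close> lies in the ideal, both have monomials free of the variables in \<open>T\<close>.
  A sum of two \<open>T\<close>-free exponents with a unique representation gives a \<open>T\<close>-free monomial of \<open>p * q\<close>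
  whose coefficient cannot cancel: other factorisations into monomials of \<open>p\<close> and \<open>q\<close> would again
  be \<open>T\<close>-free.
\<close>
lemma monomial_prime:
  assumes E: "finite E" "T \<subseteq> E"
  shows "primeideal (monomial_span E (\<lambda>f. 1 \<le> sum f T) :: ('a, 'k::field) mpoly set) (poly_ring E)"
    (is "primeideal ?P ?R")
proof (rule primeidealI)
  have T: "finite T" using E finite_subset by blast
  show "ideal ?P ?R" using mono_sum[OF T] by (rule monomial_span_ideal)
  show "cring ?R" by (rule poly_ring_cring)
  have "(1 :: ('a, 'k) mpoly) \<in> carrier ?R" "(1 :: ('a, 'k) mpoly) \<notin> ?P"
    using T by (auto simp: monomial_span_def)
  then show "carrier ?R \<noteq> ?P" by blast
  fix p q :: "('a, 'k) mpoly" assume p: "p \<in> carrier ?R" and q: "q \<in> carrier ?R" and pq: "p \<otimes>\<^bsub>?R\<^esub> q \<in> ?P"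
  show "p \<in> ?P \<or> q \<in> ?P"
  proof (rule ccontr)
    assume notin: "\<not> (p \<in> ?P \<or> q \<in> ?P)"
    define free where "free r = {m \<in> Poly_Mapping.keys r. sum (Poly_Mapping.lookup m) T = 0}"
      for r :: "('a, 'k) mpoly"
    have free_ne: "free r \<noteq> {}" if "r \<in> carrier ?R" "r \<notin> ?P" for r
      using that by (auto simp: monomial_span_def free_def Suc_le_eq)
    have outside: "Poly_Mapping.lookup m e = 0" if "r \<in> carrier ?R" "m \<in> free r" "e \<notin> E" for r m e
    proof -
      have "Poly_Mapping.keys m \<subseteq> E" using that by (auto simp: monomial_span_def free_def)
      then show ?thesis using that(3) by (auto simp: in_keys_iff)
    qed
    have "\<exists>a\<in>free p. \<exists>b\<in>free q. \<forall>a'\<in>free p. \<forall>b'\<in>free q. a' + b' = a + b \<longrightarrow> a' = a \<and> b' = b"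
    proof (rule unique_sum[OF E(1)])
      show "free p \<noteq> {}" "free q \<noteq> {}" using free_ne notin p q by blast+
      show "finite (free p)" "finite (free q)" by (simp_all add: free_def)
      show "Poly_Mapping.lookup a e = Poly_Mapping.lookup a' e"
        if "a \<in> free p" "a' \<in> free p" "e \<notin> E" for a a' e
        using outside[OF p that(1,3)] outside[OF p that(2,3)] by simp
      show "Poly_Mapping.lookup b e = Poly_Mapping.lookup b' e"
        if "b \<in> free q" "b' \<in> free q" "e \<notin> E" for b b' e
        using outside[OF q that(1,3)] outside[OF q that(2,3)] by simp
    qed
    then obtain a b where ab: "a \<in> free p" "b \<in> free q"
      and uniq: "\<And>a' b'. a' \<in> free p \<Longrightarrow> b' \<in> free q \<Longrightarrow> a' + b' = a + b \<Longrightarrow> a' = a \<and> b' = b"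
      by blast
    have sum_add: "sum (Poly_Mapping.lookup (k + l)) T = sum (Poly_Mapping.lookup k) T + sum (Poly_Mapping.lookup l) T"
      for k l :: "'a \<Rightarrow>\<^sub>0 nat"
      by (simp add: lookup_add sum.distrib)
    have zero: "sum (Poly_Mapping.lookup (a + b)) T = 0" using ab unfolding sum_add by (simp add: free_def)
    have "Poly_Mapping.lookup (p * q) (a + b) = Poly_Mapping.lookup p a * Poly_Mapping.lookup q b"
    proof (rule lookup_mult_unique)
      show "a' = a \<and> b' = b"
        if "a' \<in> Poly_Mapping.keys p" "b' \<in> Poly_Mapping.keys q" "a' + b' = a + b" for a' b'
      proof (rule uniq[OF _ _ that(3)])
        have "sum (Poly_Mapping.lookup a') T + sum (Poly_Mapping.lookup b') T = 0"
          using zero that(3) sum_add by metis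
        then show "a' \<in> free p" "b' \<in> free q" using that by (simp_all add: free_def)
      qed
    qed (use ab in \<open>auto simp: free_def\<close>)
    then have "a + b \<in> Poly_Mapping.keys (p * q)" using ab by (simp add: free_def in_keys_iff)
    with pq zero show False by (auto simp: monomial_span_def)
  qed
qed

section \<open>Minimal primes and symbolic powers of facet ideals\<close>

lemma pvar_mem_monomial_prime:
  assumes "finite T"
  shows "pvar e \<in> (monomial_span E (\<lambda>f. 1 \<le> sum f T) :: ('a, 'k::field) mpoly set) \<longleftrightarrow> e \<in> E \<and> e \<in> T"
  using assms by (simp add: pvar_def single_mem_monomial_span lookup_single when_def)

lemma facet_subset_monomial_prime:
  assumes "T \<in> transversals E \<B>" "finite E"
  shows "monomial_span E (packs \<B> 1) \<subseteq> (monomial_span E (\<lambda>f. 1 \<le> sum f T) :: ('a, 'k::field) mpoly set)"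
proof (rule monomial_span_mono[OF order_refl])
  fix f assume "packs \<B> 1 f"
  then obtain e where "e \<in> T" "1 \<le> f e" using assms unfolding packs_1 transversals_def by blast
  moreover have "finite T" using assms finite_subset unfolding transversals_def by blast
  ultimately show "1 \<le> sum f T" by (meson member_le_sum order_trans zero_le)
qed

text \<open>
  A prime ideal that contains the product of the variables in \<open>B\<close> contains one of them, so the
  variables in \<open>Q\<close> form a transversal.
\<close>
lemma prime_contains_monomial_prime:
  fixes Q :: "('a, 'k::field) mpoly set"
  assumes E: "finite E" "\<B> \<subseteq> Pow E"
    and Q: "primeideal Q (poly_ring E)" "monomial_span E (packs \<B> 1) \<subseteq> Q"
  defines "T \<equiv> {e \<in> E. pvar e \<in> Q}"
  shows "T \<in> transversals E \<B>" "monomial_span E (\<lambda>f. 1 \<le> sum f T) \<subseteq> Q"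
proof -
  interpret primeideal Q "poly_ring E" by fact
  have fin: "finite B" if "B \<in> \<B>" for B using PowD[OF subsetD[OF E(2) that]] E(1) by (rule finite_subset)
  have pvar_carr: "(pvar e :: ('a, 'k) mpoly) \<in> carrier (poly_ring E)" if "e \<in> E" for e
    using that by (simp add: pvar_def single_mem_monomial_span)
  have one: "(1 :: ('a, 'k) mpoly) \<notin> Q" using one_imp_carrier I_notcarr by auto
  have carr: "(\<Prod>e\<in>B. pvar e :: ('a, 'k) mpoly) \<in> carrier (poly_ring E)" if "finite B" "B \<subseteq> E" for B
    using that
  proof (induction B rule: finite_induct)
    case (insert x B)
    then show ?case using m_closed[of "pvar x" "\<Prod>e\<in>B. pvar e"] pvar_carr by simp
  qed (use one_closed in simp)
  have prod: "\<exists>e\<in>B. pvar e \<in> Q" if "finite B" "B \<subseteq> E" "(\<Prod>e\<in>B. pvar e) \<in> Q" for B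
    using that
  proof (induction B rule: finite_induct)
    case (insert x B)
    then show ?case using I_prime[of "pvar x" "\<Prod>e\<in>B. pvar e"] pvar_carr carr[of B] by auto
  qed (use one in simp)
  have gens: "{\<Prod>e\<in>B. pvar e | B. B \<in> \<B>} \<subseteq> Q"
  proof -
    have "{\<Prod>e\<in>B. pvar e | B. B \<in> \<B>} \<subseteq> carrier (poly_ring E :: ('a, 'k) mpoly ring)"
      using carr[OF fin PowD[OF subsetD[OF E(2)]]] by (intro subsetI) (elim CollectE exE conjE, simp only:)
    from genideal_self[OF this]
    have "{\<Prod>e\<in>B. pvar e | B. B \<in> \<B>} \<subseteq> (monomial_span E (packs \<B> 1) :: ('a, 'k) mpoly set)"
      by (simp only: genideal_squarefree_monomials[OF E])
    then show ?thesis using Q(2) by (rule order_trans)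
  qed
  show "T \<in> transversals E \<B>"
    unfolding transversals_def
  proof (intro CollectI conjI ballI)
    fix B assume B: "B \<in> \<B>"
    then have "(\<Prod>e\<in>B. pvar e) \<in> Q" using gens by blast
    then obtain e where "e \<in> B" "pvar e \<in> Q" using prod[OF fin[OF B] PowD[OF subsetD[OF E(2) B]]] by blast
    then show "B \<inter> T \<noteq> {}" using PowD[OF subsetD[OF E(2) B]] unfolding T_def by blast
  qed (simp add: T_def)
  show "monomial_span E (\<lambda>f. 1 \<le> sum f T) \<subseteq> Q"
  proof (rule monomial_span_subset_ideal[OF is_ideal])
    fix m :: "'a \<Rightarrow>\<^sub>0 nat"
    assume m: "Poly_Mapping.keys m \<subseteq> E" "1 \<le> sum (Poly_Mapping.lookup m) T"
    then have "sum (Poly_Mapping.lookup m) T \<noteq> 0" by simp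
    then obtain e where e: "e \<in> T" "1 \<le> Poly_Mapping.lookup m e"
      by (elim sum.not_neutral_contains_not_neutral) simp
    have me: "m = (m - Poly_Mapping.single e 1) + Poly_Mapping.single e 1"
      using e(2) by (intro poly_mapping_eqI) (auto simp: lookup_add lookup_minus lookup_single when_def)
    have "Poly_Mapping.keys (m - Poly_Mapping.single e 1) \<subseteq> E"
      using m(1) me keys_add_nat[of "m - Poly_Mapping.single e 1" "Poly_Mapping.single e 1"] by simp
    then have "(Poly_Mapping.single (m - Poly_Mapping.single e 1) 1 :: ('a, 'k) mpoly) \<in> carrier (poly_ring E)"
      by (simp add: single_mem_monomial_span)
    moreover have "pvar e \<in> Q" using e by (simp add: T_def)
    ultimately have "Poly_Mapping.single (m - Poly_Mapping.single e 1) 1 * pvar e \<in> Q"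
      using I_l_closed[of "pvar e"] by simp
    then show "Poly_Mapping.single m 1 \<in> Q" by (simp only: pvar_def mult_single mult_1_left me[symmetric])
  qed
qed

lemma minimal_primes_monomial:
  assumes E: "finite E" "\<B> \<subseteq> Pow E"
  shows "minimal_primes (poly_ring E) (monomial_span E (packs \<B> 1)) =
    {monomial_span E (\<lambda>f. 1 \<le> sum f T) :: ('a, 'k::field) mpoly set | T.
       T \<in> transversals E \<B> \<and> (\<forall>T'\<in>transversals E \<B>. T' \<subseteq> T \<longrightarrow> T' = T)}"
    (is "minimal_primes ?R ?I = ?M")
proof (intro equalityI subsetI)
  have sub: "T \<subseteq> E" if "T \<in> transversals E \<B>" for T using that by (simp add: transversals_def)
  have fin: "finite T" if "T \<in> transversals E \<B>" for T using sub[OF that] E(1) finite_subset by blast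
  let ?P = "\<lambda>T. monomial_span E (\<lambda>f. 1 \<le> sum f T) :: ('a, 'k) mpoly set"
  have prime: "primeideal (?P T) ?R \<and> ?I \<subseteq> ?P T" if "T \<in> transversals E \<B>" for T
    using monomial_prime[OF E(1) sub[OF that]] facet_subset_monomial_prime[OF that E(1)] by blast
  have mono: "T \<subseteq> T' \<longleftrightarrow> ?P T \<subseteq> ?P T'" if "T \<in> transversals E \<B>" "T' \<in> transversals E \<B>" for T T'
  proof
    assume "T \<subseteq> T'"
    then show "?P T \<subseteq> ?P T'"
      using fin[OF that(2)] by (intro monomial_span_mono) (auto intro: order_trans[OF _ sum_mono2])
  next
    assume P: "?P T \<subseteq> ?P T'"
    show "T \<subseteq> T'"
    proof
      fix e assume "e \<in> T"
      then have "pvar e \<in> ?P T" using pvar_mem_monomial_prime[OF fin] that sub by blast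
      then show "e \<in> T'" using P pvar_mem_monomial_prime[OF fin] that by blast
    qed
  qed
  fix Q :: "('a, 'k) mpoly set"
  {
    assume "Q \<in> minimal_primes ?R ?I"
    then have Q: "primeideal Q ?R" "?I \<subseteq> Q"
      and min: "\<And>Q'. primeideal Q' ?R \<Longrightarrow> ?I \<subseteq> Q' \<Longrightarrow> Q' \<subseteq> Q \<Longrightarrow> Q' = Q"
      unfolding minimal_primes_def by blast+
    obtain T where T: "T \<in> transversals E \<B>" "?P T \<subseteq> Q"
      using prime_contains_monomial_prime[OF E Q] by blast
    then have eq: "?P T = Q" using prime min by blast
    have "T' = T" if T': "T' \<in> transversals E \<B>" "T' \<subseteq> T" for T'
    proof -
      have "?P T' \<subseteq> Q" using mono[OF T'(1) T(1)] T'(2) eq by simp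
      then have "?P T' = Q" using min prime[OF T'(1)] by simp
      then show ?thesis using mono[OF T(1) T'(1)] T'(2) eq by simp
    qed
    then show "Q \<in> ?M" using T eq by blast
  next
    assume "Q \<in> ?M"
    then obtain T where T: "Q = ?P T" "T \<in> transversals E \<B>"
      and min: "\<And>T'. T' \<in> transversals E \<B> \<Longrightarrow> T' \<subseteq> T \<Longrightarrow> T' = T" by blast
    have "Q' = Q" if Q': "primeideal Q' ?R" "?I \<subseteq> Q'" "Q' \<subseteq> Q" for Q'
    proof -
      obtain T' where T': "T' \<in> transversals E \<B>" "?P T' \<subseteq> Q'"
        using prime_contains_monomial_prime[OF E Q'(1,2)] by blast
      have "?P T' \<subseteq> ?P T" using T'(2) Q'(3) T(1) by simp
      then have "T' = T" using mono[OF T'(1) T(2)] min[OF T'(1)] by simp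
      then show ?thesis using T(1) T'(2) Q'(3) by simp
    qed
    then show "Q \<in> minimal_primes ?R ?I" unfolding minimal_primes_def using prime T by blast
  }
qed

text \<open>
  A monomial of weight at least \<open>n + 1\<close> on \<open>T\<close> is divisible by a variable in \<open>T\<close>, and the
  quotient has weight at least \<open>n\<close>.
\<close>
lemma monomial_prime_power:
  assumes T: "finite T"
  shows "monomial_span E (\<lambda>f. 1 \<le> sum f T) [^]\<^bsub>ideals_set (poly_ring E)\<^esub> n =
    (monomial_span E (\<lambda>f. n \<le> sum f T) :: ('a, 'k::field) mpoly set)"
proof (rule monomial_span_power[where Q = "\<lambda>n f. n \<le> sum f T"])
  fix n and h :: "'a \<Rightarrow> nat"
  show "Suc n \<le> sum h T \<longleftrightarrow> (\<exists>f g. n \<le> sum f T \<and> 1 \<le> sum g T \<and> h = (\<lambda>e. f e + g e))"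
  proof
    assume h: "Suc n \<le> sum h T"
    then have "sum h T \<noteq> 0" by simp
    then obtain x where x: "x \<in> T" "h x \<noteq> 0" by (rule sum.not_neutral_contains_not_neutral)
    define g where "g e = (if e = x then 1 else 0 :: nat)" for e
    have split: "h = (\<lambda>e. (h e - g e) + g e)" using x(2) by (auto simp: g_def)
    have g: "sum g T = 1" using T x(1) by (simp add: g_def)
    have "sum h T = (\<Sum>e\<in>T. (h e - g e) + g e)" using x(2) by (intro sum.cong) (auto simp: g_def)
    also have "\<dots> = (\<Sum>e\<in>T. h e - g e) + sum g T" by (rule sum.distrib)
    finally have "sum h T = (\<Sum>e\<in>T. h e - g e) + sum g T" .
    then have "n \<le> (\<Sum>e\<in>T. h e - g e)" using h g by simp
    then show "\<exists>f g. n \<le> sum f T \<and> 1 \<le> sum g T \<and> h = (\<lambda>e. f e + g e)"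
      using split g by (intro exI[of _ "\<lambda>e. h e - g e"] exI[of _ g]) simp
  next
    assume "\<exists>f g. n \<le> sum f T \<and> 1 \<le> sum g T \<and> h = (\<lambda>e. f e + g e)"
    then show "Suc n \<le> sum h T" by (auto simp: sum.distrib)
  qed
qed (use mono_sum[OF T] in auto)

text \<open>
  Every transversal of a finite ground set contains a minimal one, whose weight is not larger.
  The intersection over the minimal primes thus becomes a condition on all transversals, and
  this form is inherited well by direct sums.
\<close>
lemma covers_iff_minimal:
  assumes E: "finite E"
  shows "covers E \<B> s f \<longleftrightarrow> (\<forall>T\<in>transversals E \<B>.
    (\<forall>T'\<in>transversals E \<B>. T' \<subseteq> T \<longrightarrow> T' = T) \<longrightarrow> s \<le> sum f T)"
proof
  assume min: "\<forall>T\<in>transversals E \<B>. (\<forall>T'\<in>transversals E \<B>. T' \<subseteq> T \<longrightarrow> T' = T) \<longrightarrow> s \<le> sum f T"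
  show "covers E \<B> s f"
    unfolding covers_def
  proof
    fix T assume T: "T \<in> transversals E \<B>"
    have "finite (transversals E \<B>)"
    proof (rule finite_subset)
      show "transversals E \<B> \<subseteq> Pow E" by (auto simp: transversals_def)
      show "finite (Pow E)" using E by simp
    qed
    from finite_has_minimal2[OF this T] obtain T0
      where T0: "T0 \<in> transversals E \<B>" "T0 \<subseteq> T"
        and T0_min: "\<forall>T'\<in>transversals E \<B>. T' \<subseteq> T0 \<longrightarrow> T0 = T'"
      by (elim bexE conjE) (rule that)
    have "\<forall>T'\<in>transversals E \<B>. T' \<subseteq> T0 \<longrightarrow> T' = T0" using T0_min by (simp add: eq_commute)
    then have "s \<le> sum f T0" using min T0(1) by simp
    also have "\<dots> \<le> sum f T"
      using T T0(2) E by (intro sum_mono2) (auto simp: transversals_def intro: finite_subset)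
    finally show "s \<le> sum f T" .
  qed
qed (simp add: covers_def)

lemma symbolic_power_monomial:
  assumes E: "finite E" "\<B> \<subseteq> Pow E"
  shows "symbolic_power (poly_ring E) (monomial_span E (packs \<B> 1)) s =
    (monomial_span E (covers E \<B> s) :: ('a, 'k::field) mpoly set)"
proof -
  define \<T> where "\<T> = {T \<in> transversals E \<B>. \<forall>T'\<in>transversals E \<B>. T' \<subseteq> T \<longrightarrow> T' = T}"
  have fin: "finite T" if "T \<in> \<T>" for T
    using that E(1) finite_subset unfolding \<T>_def transversals_def by blast
  have primes: "minimal_primes (poly_ring E) (monomial_span E (packs \<B> 1)) =
      (\<lambda>T. monomial_span E (\<lambda>f. 1 \<le> sum f T) :: ('a, 'k) mpoly set) ` \<T>"
    unfolding minimal_primes_monomial[OF E] \<T>_def by blast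
  have cov: "covers E \<B> s f \<longleftrightarrow> (\<forall>T\<in>\<T>. s \<le> sum f T)" for f
    unfolding covers_iff_minimal[OF E(1)] \<T>_def by blast
  have "p \<in> symbolic_power (poly_ring E) (monomial_span E (packs \<B> 1)) s \<longleftrightarrow>
      p \<in> carrier (poly_ring E) \<and> (\<forall>T\<in>\<T>. p \<in> monomial_span E (\<lambda>f. s \<le> sum f T))"
    for p :: "('a, 'k) mpoly"
    unfolding symbolic_power_def primes using monomial_prime_power[OF fin, where ?'k = 'k] by auto
  then show ?thesis unfolding monomial_span_def cov poly_ring_def by auto
qed

lemma facet_power:
  "monomial_span E (packs \<B> 1) [^]\<^bsub>ideals_set (poly_ring E)\<^esub> n =
    (monomial_span E (packs \<B> n) :: ('a, 'k::field) mpoly set)"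
  by (rule monomial_span_power) (simp_all only: mono_packs packs_0 packs_Suc)

section \<open>Asymptotic invariants in terms of exponents\<close>

lemma monomial_on:
  fixes f :: "'a \<Rightarrow> nat"
  assumes "finite E"
  obtains m where "Poly_Mapping.keys m \<subseteq> E" "\<And>e. e \<in> E \<Longrightarrow> Poly_Mapping.lookup m e = f e"
proof -
  obtain m where "Poly_Mapping.lookup m = (\<lambda>e. if e \<in> E then f e else 0)" "Poly_Mapping.keys m \<subseteq> E"
    by (rule monomial_of_exponents[OF assms, of "\<lambda>e. if e \<in> E then f e else 0"]) (auto split: if_splits)
  then show ?thesis by (intro that[of m]) auto
qed

lemma monomial_span_subset_iff:
  assumes E: "finite E"
    and P: "\<And>f g. (\<And>e. e \<in> E \<Longrightarrow> f e = g e) \<Longrightarrow> P f = P g"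
    and Q: "\<And>f g. (\<And>e. e \<in> E \<Longrightarrow> f e = g e) \<Longrightarrow> Q f = Q g"
  shows "(monomial_span E P :: ('a, 'k::field) mpoly set) \<subseteq> monomial_span E Q \<longleftrightarrow> (\<forall>f. P f \<longrightarrow> Q f)"
proof (intro iffI allI impI)
  fix f assume sub: "(monomial_span E P :: ('a, 'k) mpoly set) \<subseteq> monomial_span E Q" and f: "P f"
  obtain m where m: "Poly_Mapping.keys m \<subseteq> E" "\<And>e. e \<in> E \<Longrightarrow> Poly_Mapping.lookup m e = f e"
    using monomial_on[OF E, of f] by blast
  have "(Poly_Mapping.single m 1 :: ('a, 'k) mpoly) \<in> monomial_span E P"
    using m(1) f P[OF m(2)] by (simp add: single_mem_monomial_span)
  then have "(Poly_Mapping.single m 1 :: ('a, 'k) mpoly) \<in> monomial_span E Q" using sub by blast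
  then show "Q f" using Q[OF m(2)] by (simp add: single_mem_monomial_span)
next
  assume "\<forall>f. P f \<longrightarrow> Q f"
  then show "(monomial_span E P :: ('a, 'k) mpoly set) \<subseteq> monomial_span E Q"
    by (intro monomial_span_mono) auto
qed

lemma initial_degree_monomial_span:
  assumes E: "finite E"
    and Q: "\<And>f g. (\<And>e. e \<in> E \<Longrightarrow> f e = g e) \<Longrightarrow> Q f = Q g"
  shows "initial_degree (monomial_span E Q :: ('a, 'k::field) mpoly set) =
    (LEAST d. \<exists>f. Q f \<and> sum f E = d)"
proof -
  have "(\<exists>p\<in>(monomial_span E Q :: ('a, 'k) mpoly set). p \<noteq> 0 \<and> homogeneous d p) \<longleftrightarrow>
      (\<exists>f. Q f \<and> sum f E = d)" for d
  proof
    assume "\<exists>p\<in>(monomial_span E Q :: ('a, 'k) mpoly set). p \<noteq> 0 \<and> homogeneous d p"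
    then obtain p :: "('a, 'k) mpoly" and m where p: "p \<in> monomial_span E Q" "homogeneous d p"
      and m: "m \<in> Poly_Mapping.keys p"
      by (metis ex_in_conv keys_eq_empty)
    have "sum (Poly_Mapping.lookup m) E = sum (Poly_Mapping.lookup m) (Poly_Mapping.keys m)"
      using E p(1) m by (intro sum.mono_neutral_right) (auto simp: monomial_span_def in_keys_iff)
    also have "\<dots> = d" using p(2) m by (simp add: homogeneous_def)
    finally show "\<exists>f. Q f \<and> sum f E = d" using p(1) m by (auto simp: monomial_span_def)
  next
    assume "\<exists>f. Q f \<and> sum f E = d"
    then obtain f where f: "Q f" "sum f E = d" by blast
    obtain m where m: "Poly_Mapping.keys m \<subseteq> E" "\<And>e. e \<in> E \<Longrightarrow> Poly_Mapping.lookup m e = f e"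
      using monomial_on[OF E, of f] by blast
    let ?p = "Poly_Mapping.single m 1 :: ('a, 'k) mpoly"
    have "sum (Poly_Mapping.lookup m) (Poly_Mapping.keys m) = sum (Poly_Mapping.lookup m) E"
      using E m(1) by (intro sum.mono_neutral_left) (auto simp: in_keys_iff)
    also have "\<dots> = d" using f(2) m(2) by simp
    finally have "homogeneous d ?p" by (simp add: homogeneous_def)
    moreover have "?p \<in> monomial_span E Q"
      using m(1) f(1) Q[OF m(2)] by (simp add: single_mem_monomial_span)
    moreover have "?p \<noteq> 0" by (metis keys_eq_empty keys_single insert_not_empty one_neq_zero)
    ultimately show "\<exists>p\<in>(monomial_span E Q :: ('a, 'k) mpoly set). p \<noteq> 0 \<and> homogeneous d p" by blast
  qed
  then show ?thesis unfolding initial_degree_def by simp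
qed

locale facets =
  fixes M :: "'e matroid_data"
  assumes finite_ground: "finite (ground M)"
    and bases_sub: "bases M \<subseteq> Pow (ground M)"
    and bases_ne: "bases M \<noteq> {}"
begin

lemma facet_ideal: "facet_ideal TYPE('k::field) M = monomial_span (ground M) (packs (bases M) 1)"
  unfolding facet_ideal_def by (rule genideal_squarefree_monomials[OF finite_ground bases_sub])

lemma waldschmidt_constant_LIMSEQ:
  "(\<lambda>s. real (least_weight (ground M) (bases M) s) / real s)
     \<longlonglongrightarrow> waldschmidt_constant (poly_ring (ground M)) (facet_ideal TYPE('k::field) M)"
proof -
  have "initial_degree (symbolic_power (poly_ring (ground M)) (facet_ideal TYPE('k) M) s) =
      least_weight (ground M) (bases M) s" for s
    unfolding facet_ideal symbolic_power_monomial[OF finite_ground bases_sub] least_weight_def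
    by (intro initial_degree_monomial_span finite_ground covers_cong)
  moreover have "convergent (\<lambda>s. real (least_weight (ground M) (bases M) s) / real s)"
    by (intro subadditive_quotient_convergent least_weight_subadditive finite_ground bases_ne)
  ultimately show ?thesis unfolding waldschmidt_constant_def by (simp add: convergent_LIMSEQ_iff)
qed

lemma symbolic_power_subset_power_iff:
  "symbolic_power (poly_ring (ground M)) (facet_ideal TYPE('k::field) M) s \<subseteq>
     facet_ideal TYPE('k) M [^]\<^bsub>ideals_set (poly_ring (ground M))\<^esub> n \<longleftrightarrow>
   contained (ground M) (bases M) s n"
  unfolding facet_ideal symbolic_power_monomial[OF finite_ground bases_sub] facet_power contained_def
  by (intro monomial_span_subset_iff finite_ground covers_cong packs_cong[OF bases_sub])

end

lemma facets_matroid: "matroid M \<Longrightarrow> facets M"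
  by (auto simp: matroid_def facets_def)

section \<open>Direct sums of matroids\<close>

theorem theorem3p3:
  fixes M1 M2 M :: "'e matroid_data"
  assumes "matroid M1" and "matroid M2"
    and "ground M1 \<inter> ground M2 = {}"
    and "matroid_rank M1 < card (ground M1)"
    and "matroid_rank M2 < card (ground M2)"
    and "M = direct_sum M1 M2"
  shows
    "facet_ideal TYPE('k::field) M =
       ideal_prod (poly_ring (ground M))
         (genideal (poly_ring (ground M)) (facet_ideal TYPE('k) M1))
         (genideal (poly_ring (ground M)) (facet_ideal TYPE('k) M2)) \<and>
     waldschmidt_constant (poly_ring (ground M)) (facet_ideal TYPE('k) M) =
       waldschmidt_constant (poly_ring (ground M1)) (facet_ideal TYPE('k) M1) +
       waldschmidt_constant (poly_ring (ground M2)) (facet_ideal TYPE('k) M2) \<and>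
     asymptotic_resurgence (poly_ring (ground M)) (facet_ideal TYPE('k) M) =
       max (asymptotic_resurgence (poly_ring (ground M1)) (facet_ideal TYPE('k) M1))
           (asymptotic_resurgence (poly_ring (ground M2)) (facet_ideal TYPE('k) M2))"
proof (intro conjI)
  have "matroid M" using matroid_direct_sum[OF assms(1-3)] assms(6) by simp
  interpret M: facets M using \<open>matroid M\<close> by (rule facets_matroid)
  interpret M1: facets M1 using assms(1) by (rule facets_matroid)
  interpret M2: facets M2 using assms(2) by (rule facets_matroid)
  have ground: "ground M = ground M1 \<union> ground M2" and bases: "bases M = joins (bases M1) (bases M2)"
    by (simp_all add: assms(6) direct_sum_def joins_def)
  note disj = \<open>ground M1 \<inter> ground M2 = {}\<close>
  note join_facts = M1.finite_ground M2.finite_ground M1.bases_ne M2.bases_ne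
    M1.bases_sub M2.bases_sub disj

  have packs_M: "packs (bases M) 1 =
      (\<lambda>h. \<exists>f g. packs (bases M1) 1 f \<and> packs (bases M2) 1 g \<and> h = (\<lambda>e. f e + g e))"
    unfolding bases by (rule ext) (rule packs_joins_split[OF M1.bases_sub M2.bases_sub disj])
  have sub: "ground M1 \<subseteq> ground M" "ground M2 \<subseteq> ground M" by (simp_all add: ground)
  show "facet_ideal TYPE('k) M = ideal_prod (poly_ring (ground M))
         (genideal (poly_ring (ground M)) (facet_ideal TYPE('k) M1))
         (genideal (poly_ring (ground M)) (facet_ideal TYPE('k) M2))"
    unfolding M.facet_ideal M1.facet_ideal M2.facet_ideal
      genideal_extension[OF M.finite_ground sub(1) M1.bases_sub]
      genideal_extension[OF M.finite_ground sub(2) M2.bases_sub]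
      ideal_prod_monomial_span[OF mono_packs mono_packs] packs_M ..

  have "(\<lambda>s. real (least_weight (ground M) (bases M) s) / real s) \<longlonglongrightarrow>
      waldschmidt_constant (poly_ring (ground M1)) (facet_ideal TYPE('k) M1) +
      waldschmidt_constant (poly_ring (ground M2)) (facet_ideal TYPE('k) M2)"
    using tendsto_add[OF M1.waldschmidt_constant_LIMSEQ M2.waldschmidt_constant_LIMSEQ]
    by (simp add: ground bases least_weight_joins[OF join_facts] add_divide_distrib)
  then show "waldschmidt_constant (poly_ring (ground M)) (facet_ideal TYPE('k) M) =
       waldschmidt_constant (poly_ring (ground M1)) (facet_ideal TYPE('k) M1) +
       waldschmidt_constant (poly_ring (ground M2)) (facet_ideal TYPE('k) M2)"
    using M.waldschmidt_constant_LIMSEQ LIMSEQ_unique by blast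

  \<comment> \<open>Indexing the two containments by a Boolean makes both instances of one family.\<close>
  define C where "C i = (if i then contained (ground M1) (bases M1) else contained (ground M2) (bases M2))"
    for i
  have C: "contained (ground M) (bases M) s n \<longleftrightarrow> C True s n \<and> C False s n" for s n
    by (simp add: C_def ground bases contained_joins[OF join_facts])
  have step: "\<forall>\<^sub>F t in sequentially. C i (s * t) (r * t)"
    if "\<exists>\<^sub>F t in sequentially. C i (s' * t) (r' * t)" "0 < s'" "r * s' < r' * s" for i s r s' r'
    using that contained_eventually[OF M1.finite_ground M1.bases_sub, of s' r' r s]
      contained_eventually[OF M2.finite_ground M2.bases_sub, of s' r' r s]
    by (cases i) (simp_all add: C_def)
  show "asymptotic_resurgence (poly_ring (ground M)) (facet_ideal TYPE('k) M) =
       max (asymptotic_resurgence (poly_ring (ground M1)) (facet_ideal TYPE('k) M1))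
           (asymptotic_resurgence (poly_ring (ground M2)) (facet_ideal TYPE('k) M2))"
    using Sup_failing_ratios_conj[of C True False, OF step]
    unfolding asymptotic_resurgence_def M.symbolic_power_subset_power_iff
      M1.symbolic_power_subset_power_iff M2.symbolic_power_subset_power_iff C
    by (simp add: C_def)
qed

end
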